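(* Let $m\ge 0$ be an integer, let $\lambda,\delta,\rho$ be three proper $m$-marked cycle shapes, and let $n\geq m$ be a natural number satisfying $n\geq |\lambda|$, $n\ge |\delta|$ and $n\ge|\rho|$. Then the structure coefficient $c_{\underline{\lambda}_n,\underline{\delta}_n}^{\underline{\rho}_n}(n)$ of the $m$-centraliser algebra $Z_{n,m}$ can be written as $$c_{\underline{\lambda}_n,\underline{\delta}_n}^{\underline{\rho}_n}(n)=\sum_{k=0}^{n-|\rho|}k_{\lambda\delta}^{\rho^k}\binom{n-|\rho|}{k},$$ where the $k_{\lambda\delta}^{\rho^k}$ (the structure coefficients of the algebra $\mathcal{A}^m_\infty$ of invariant formal combinations of $m$-partial permutations of $\mathbb{N}$) are integers independent of $n$.
   Context: Notation: $\mathbb{N}=\{1,2,3,\dots\}$, $[n]=\{1,\dots,n\}$, $[0]=\emptyset$; $\mathcal{S}_d$ is the group of permutations of a finite set $d$, and $\mathcal{S}_n=\mathcal{S}_{[n]}$. Products of permutations are compositions. For $0\le m\le n$, $Stab_n(m)$ is the subgroup of $\mathcal{S}_n$ of permutations fixing every element of $[m]$. Marked cycle shapes: let $\ast$ be a formal symbol. An $m$-marked cycle shape is a finite collection (multiset) of cycles (nonempty words up to cyclic rotation) with entries in $[m]\cup\{\ast\}$ such that each element of $[m]$ appears exactly once in total and $\ast$ appears $r$ times in total for some integer $r\ge 0$. Its size is $|\rho|=m+r$, and $m_1(\rho)$ is the number of cycles of $\rho$ equal to $(\ast)$ (cycles $(a)$ with $a\in[m]$ are not counted). $\rho$ is proper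 if $m_1(\rho)=0$. $\mathcal{P}^m$ is the set of all $m$-marked cycle shapes and $\mathcal{P}^m_n$ the set of those of size $n$. For $k\ge 0$, $\rho^k$ is the shape obtained from $\rho$ by adding $k$ cycles $(\ast)$; for $n\ge|\rho|$, $\underline{\rho}_n:=\rho^{\,n-|\rho|}\in\mathcal{P}^m_n$. If $d$ is a finite set with $[m]\subseteq d\subset\mathbb{N}$ and $\omega\in\mathcal{S}_d$, the $m$-marked cycle type of $\omega$ is the shape of size $|d|$ obtained from the full cycle notation of $\omega$ (fixed points included) by replacing each element of $d\setminus[m]$ by $\ast$. The $m$-centraliser algebra: $Z_{n,m}=\{z\in\mathbb{Z}[\mathcal{S}_n]: \tau z=z\tau \text{ for all }\tau\in Stab_n(m)\}$. For $\lambda\in\mathcal{P}^m_n$, let $K_\lambda$ be the sum of all permutations of $[n]$ with $m$-marked cycle type $\lambda$. The $K_\lambda$, $\lambda\in\mathcal{P}^m_n$, form a $\mathbb{Z}$-basis of $Z_{n,m}$, and the structure coefficients $c_{\lambda,\delta}^{\rho}(n)$ (for $\lambda,\delta,\rho\in\mathcal{P}^m_n$) are defined by $K_\lambda K_\delta=\sum_{\rho\in\mathcal{P}^m_n}c_{\lambda,\delta}^\rho(n)K_\rho$. The algebra $\mathcal{A}^m_\infty$: an $m$-partial permutation of $\mathbb{N}$ is a pair $(d,\omega)$ with $d$ a finite set, $[m]\subseteq d\subset\mathbb{N}$, and $\omega\in\mathcal{S}_d$. For such a pair, $\widetilde{\omega}$ is the permutation of $\mathbb{N}$ equal to $\omega$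 on $d$ and to the identity off $d$. The product is $(d_1,\omega_1)\cdot(d_2,\omega_2)=(d_1\cup d_2,(\widetilde{\omega}_1\circ\widetilde{\omega}_2)_{|d_1\cup d_2})$. Let $\mathcal{B}^m_\infty$ be the $\mathbb{C}$-algebra of all formal, possibly infinite, sums $\sum b_{d,\omega}(d,\omega)$ over $m$-partial permutations of $\mathbb{N}$ with $b_{d,\omega}\in\mathbb{C}$, with the product extended linearly (each $(d,\omega)$ has only finitely many factorizations). Let $Stab_{\mathbb{N}}(m)$ be the group of finitely supported permutations of $\mathbb{N}$ fixing each element of $[m]$, acting by $\sigma\cdot(d,\omega)=(\sigma(d),\sigma\circ\omega\circ\sigma^{-1})$, and let $\mathcal{A}^m_\infty$ be the subalgebra of invariant elements of $\mathcal{B}^m_\infty$. For $\rho\in\mathcal{P}^m$, let ${\bf A}_\rho\in\mathcal{A}^m_\infty$ be the sum of all $m$-partial permutations $(d,\omega)$ of $\mathbb{N}$ with $m$-marked cycle type $\rho$. Every element of $\mathcal{A}^m_\infty$ is uniquely a (possibly infinite) linear combination of the ${\bf A}_\rho$, and the coefficients $k_{\lambda\delta}^\rho$ ($\lambda,\delta,\rho\in\mathcal{P}^m$) are defined by ${\bf A}_\lambda{\bf A}_\delta=\sum_{\rho\in\mathcal{P}^m}k_{\lambda\delta}^\rho{\bf A}_\rho$. *)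

theory Defs
  imports Complex_Main "HOL-Library.Multiset" "HOL-Combinatorics.Cycles"
begin

section \<open>Words up to cyclic rotation\<close>

definition rot_equiv :: "'a list \<Rightarrow> 'a list \<Rightarrow> bool" where
  "rot_equiv xs ys \<longleftrightarrow> (\<exists>k. ys = rotate k xs)"

lemma equivp_rot_equiv: "equivp (rot_equiv :: 'a list \<Rightarrow> _)"
proof (rule equivpI)
  show "reflp (rot_equiv :: 'a list \<Rightarrow> _)"
    by (auto simp: rot_equiv_def intro!: reflpI exI[of _ 0])
  show "symp (rot_equiv :: 'a list \<Rightarrow> _)"
  proof (rule sympI)
    fix xs ys :: "'a list"
    assume "rot_equiv xs ys"
    then obtain k where ys: "ys = rotate k xs"
      by (auto simp: rot_equiv_def)
    have "k \<le> k * length xs" if "xs \<noteq> []"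
      using that by (cases xs) auto
    then have "rotate (k * length xs - k) ys = xs"
      by (cases "xs = []") (simp_all add: ys rotate_rotate)
    then show "rot_equiv ys xs"
      unfolding rot_equiv_def by (blast intro: sym)
  qed
  show "transp (rot_equiv :: 'a list \<Rightarrow> _)"
    by (rule transpI) (auto simp: rot_equiv_def rotate_rotate)
qed

quotient_type 'a cyc = "'a list" / rot_equiv
  morphisms rep_cyc Cyc
  by (rule equivp_rot_equiv)

lift_definition map_cyc :: "('a \<Rightarrow> 'b) \<Rightarrow> 'a cyc \<Rightarrow> 'b cyc" is map
  by (auto simp: rot_equiv_def rotate_map)

lift_definition letters :: "'a cyc \<Rightarrow> 'a multiset" is mset
proof -
  have "mset (rotate1 xs) = mset xs" for xs :: "'a list"
    by (cases xs) simp_all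
  then have "mset (rotate k xs) = mset xs" for k and xs :: "'a list"
    by (induct k) simp_all
  then show "mset xs = mset ys" if "rot_equiv xs ys" for xs ys :: "'a list"
    using that by (auto simp: rot_equiv_def)
qed


section \<open>Marked cycle shapes\<close>

text \<open>The formal symbol \<open>\<ast>\<close> is \<^term>\<open>None\<close>; an element \<open>a\<close> of \<open>[m]\<close> is \<^term>\<open>Some a\<close>.\<close>

type_synonym shape = "nat option cyc multiset"

definition all_letters :: "shape \<Rightarrow> nat option multiset" where
  "all_letters \<rho> = (\<Sum>C\<in>#\<rho>. letters C)"

definition marked_shapes :: "nat \<Rightarrow> shape set" where
  "marked_shapes m = {\<rho>. (\<forall>C\<in>#\<rho>. letters C \<noteq> {#}) \<and>
     set_mset (all_letters \<rho>) \<subseteq> insert None (Some ` {1..m}) \<and>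
     (\<forall>a\<in>{1..m}. count (all_letters \<rho>) (Some a) = 1)}"

definition shape_size :: "nat \<Rightarrow> shape \<Rightarrow> nat" where
  "shape_size m \<rho> = m + count (all_letters \<rho>) None"

definition marked_shapes_of_size :: "nat \<Rightarrow> nat \<Rightarrow> shape set" where
  "marked_shapes_of_size m n = {\<rho> \<in> marked_shapes m. shape_size m \<rho> = n}"

definition m1 :: "shape \<Rightarrow> nat" where
  "m1 \<rho> = count \<rho> (Cyc [None])"

definition proper :: "shape \<Rightarrow> bool" where
  "proper \<rho> \<longleftrightarrow> m1 \<rho> = 0"

definition add_stars :: "shape \<Rightarrow> nat \<Rightarrow> shape" where
  "add_stars \<rho> k = \<rho> + replicate_mset k (Cyc [None])"

definition pad :: "nat \<Rightarrow> shape \<Rightarrow> nat \<Rightarrow> shape" where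
  "pad m \<rho> n = add_stars \<rho> (n - shape_size m \<rho>)"

text \<open>The full cycle notation, fixed points included, of a permutation \<open>\<omega>\<close> of \<open>d\<close>:
  \<^term>\<open>support \<omega> x\<close> is the word \<open>x, \<omega> x, \<omega>\<^sup>2 x, \<dots>\<close> listing the orbit of \<open>x\<close> once.
  Taking the image over \<open>d\<close> identifies the words read from different starting points
  of one cycle.\<close>

definition cycles_of :: "nat set \<Rightarrow> (nat \<Rightarrow> nat) \<Rightarrow> nat cyc set" where
  "cycles_of d \<omega> = (\<lambda>x. Cyc (support \<omega> x)) ` d"

definition mark :: "nat \<Rightarrow> nat \<Rightarrow> nat option" where
  "mark m a = (if a \<in> {1..m} then Some a else None)"

definition marked_cycle_type :: "nat \<Rightarrow> nat set \<Rightarrow> (nat \<Rightarrow> nat) \<Rightarrow> shape" where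
  "marked_cycle_type m d \<omega> = image_mset (map_cyc (mark m)) (mset_set (cycles_of d \<omega>))"


section \<open>Formal sums\<close>

text \<open>A (possibly infinite) formal sum over a set \<open>S\<close> is its coefficient function, which
  vanishes off \<open>S\<close>. The product extends an operation \<open>mul\<close> on \<open>S\<close> bilinearly; it is
  only used where every element of \<open>S\<close> has finitely many factorizations.\<close>

definition formal_sums :: "'x set \<Rightarrow> ('x \<Rightarrow> 'r::comm_ring_1) set" where
  "formal_sums S = {f. \<forall>x. x \<notin> S \<longrightarrow> f x = 0}"

definition conv ::
  "'x set \<Rightarrow> ('x \<Rightarrow> 'x \<Rightarrow> 'x) \<Rightarrow> ('x \<Rightarrow> 'r::comm_ring_1) \<Rightarrow> ('x \<Rightarrow> 'r) \<Rightarrow> ('x \<Rightarrow> 'r)" where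
  "conv S mul f g = (\<lambda>z. \<Sum>(x, y) | x \<in> S \<and> y \<in> S \<and> mul x y = z. f x * g y)"

definition single :: "'x \<Rightarrow> 'x \<Rightarrow> 'r::comm_ring_1" where
  "single x = (\<lambda>y. if y = x then 1 else 0)"

text \<open>\<open>\<Sum>i\<in>I. c i \<cdot> b i\<close> as a formal sum: for the families below at most one \<open>b i\<close>
  is non-zero at a given \<open>x\<close>, so each coefficient is a finite sum even if \<open>I\<close> is infinite.\<close>

definition lin_comb :: "'i set \<Rightarrow> ('i \<Rightarrow> 'x \<Rightarrow> 'r::comm_ring_1) \<Rightarrow> ('i \<Rightarrow> 'r) \<Rightarrow> ('x \<Rightarrow> 'r)" where
  "lin_comb I b c = (\<lambda>x. \<Sum>i | i \<in> I \<and> b i x \<noteq> 0. c i * b i x)"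

text \<open>The coefficients of \<open>v\<close> in the family \<open>b\<close> indexed by \<open>I\<close>, extended by \<open>0\<close> off \<open>I\<close>.\<close>

definition coefficients ::
  "'i set \<Rightarrow> ('i \<Rightarrow> 'x \<Rightarrow> 'r::comm_ring_1) \<Rightarrow> ('x \<Rightarrow> 'r) \<Rightarrow> ('i \<Rightarrow> 'r)" where
  "coefficients I b v = (THE c. (\<forall>i. i \<notin> I \<longrightarrow> c i = 0) \<and> v = lin_comb I b c)"


section \<open>The \<open>m\<close>-centraliser algebra\<close>

definition Sym :: "nat \<Rightarrow> (nat \<Rightarrow> nat) set" where
  "Sym n = {\<sigma>. \<sigma> permutes {1..n}}"

definition Stab :: "nat \<Rightarrow> nat \<Rightarrow> (nat \<Rightarrow> nat) set" where
  "Stab n m = {\<sigma> \<in> Sym n. \<forall>a\<in>{1..m}. \<sigma> a = a}"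

abbreviation group_ring :: "nat \<Rightarrow> ((nat \<Rightarrow> nat) \<Rightarrow> int) set" where
  "group_ring n \<equiv> formal_sums (Sym n)"

abbreviation group_ring_mult ::
  "nat \<Rightarrow> ((nat \<Rightarrow> nat) \<Rightarrow> int) \<Rightarrow> ((nat \<Rightarrow> nat) \<Rightarrow> int) \<Rightarrow> ((nat \<Rightarrow> nat) \<Rightarrow> int)" where
  "group_ring_mult n \<equiv> conv (Sym n) (\<circ>)"

definition centraliser_algebra :: "nat \<Rightarrow> nat \<Rightarrow> ((nat \<Rightarrow> nat) \<Rightarrow> int) set" where
  "centraliser_algebra n m = {z \<in> group_ring n.
     \<forall>\<tau>\<in>Stab n m. group_ring_mult n (single \<tau>) z = group_ring_mult n z (single \<tau>)}"

definition K_sum :: "nat \<Rightarrow> nat \<Rightarrow> shape \<Rightarrow> (nat \<Rightarrow> nat) \<Rightarrow> int" where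
  "K_sum n m lam = (\<lambda>\<sigma>. if \<sigma> \<in> Sym n \<and> marked_cycle_type m {1..n} \<sigma> = lam then 1 else 0)"

text \<open>\<open>centraliser_coeff n m \<lambda> \<delta> \<rho>\<close> is the coefficient of \<open>K\<^sub>\<rho>\<close> in \<open>K\<^sub>\<lambda> K\<^sub>\<delta>\<close> in \<open>Z\<^sub>n\<^sub>,\<^sub>m\<close>.\<close>

definition centraliser_coeff :: "nat \<Rightarrow> nat \<Rightarrow> shape \<Rightarrow> shape \<Rightarrow> shape \<Rightarrow> int" where
  "centraliser_coeff n m lam \<delta> =
     coefficients (marked_shapes_of_size m n) (K_sum n m) (group_ring_mult n (K_sum n m lam) (K_sum n m \<delta>))"


section \<open>The algebra of invariant sums of partial permutations\<close>

type_synonym partial_perm = "nat set \<times> (nat \<Rightarrow> nat)"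

text \<open>The positive integers are \<open>\<nat>\<close>, so \<open>0\<close> is excluded from \<open>d\<close>. A permutation of \<open>d\<close>
  is represented by its extension to all of \<^typ>\<open>nat\<close> by the identity off \<open>d\<close>, so the extension
  \<open>\<omega>\<close>-tilde is the same function and the product of pairs composes them directly.\<close>

definition partial_perms :: "nat \<Rightarrow> partial_perm set" where
  "partial_perms m = {(d, \<omega>). finite d \<and> {1..m} \<subseteq> d \<and> d \<subseteq> {1..} \<and> \<omega> permutes d}"

definition pp_mult :: "partial_perm \<Rightarrow> partial_perm \<Rightarrow> partial_perm" where
  "pp_mult x y = (fst x \<union> fst y, snd x \<circ> snd y)"

definition Stab_nat :: "nat \<Rightarrow> (nat \<Rightarrow> nat) set" where
  "Stab_nat m = {\<sigma>. \<sigma> permutes {1..} \<and> finite {x. \<sigma> x \<noteq> x} \<and> (\<forall>a\<in>{1..m}. \<sigma> a = a)}"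

definition pp_act :: "(nat \<Rightarrow> nat) \<Rightarrow> partial_perm \<Rightarrow> partial_perm" where
  "pp_act \<sigma> x = (\<sigma> ` fst x, \<sigma> \<circ> snd x \<circ> inv \<sigma>)"

abbreviation B_inf :: "nat \<Rightarrow> (partial_perm \<Rightarrow> complex) set" where
  "B_inf m \<equiv> formal_sums (partial_perms m)"

abbreviation B_mult ::
  "nat \<Rightarrow> (partial_perm \<Rightarrow> complex) \<Rightarrow> (partial_perm \<Rightarrow> complex) \<Rightarrow> (partial_perm \<Rightarrow> complex)" where
  "B_mult m \<equiv> conv (partial_perms m) pp_mult"

definition A_inf :: "nat \<Rightarrow> (partial_perm \<Rightarrow> complex) set" where
  "A_inf m = {b \<in> B_inf m. \<forall>\<sigma>\<in>Stab_nat m. \<forall>x\<in>partial_perms m. b (pp_act \<sigma> x) = b x}"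

definition A_sum :: "nat \<Rightarrow> shape \<Rightarrow> partial_perm \<Rightarrow> complex" where
  "A_sum m \<rho> = (\<lambda>(d, \<omega>). if (d, \<omega>) \<in> partial_perms m \<and> marked_cycle_type m d \<omega> = \<rho> then 1 else 0)"

text \<open>\<open>partial_coeff m \<lambda> \<delta> \<rho>\<close> is the coefficient of \<open>A\<^sub>\<rho>\<close> in \<open>A\<^sub>\<lambda> A\<^sub>\<delta>\<close>.\<close>

definition partial_coeff :: "nat \<Rightarrow> shape \<Rightarrow> shape \<Rightarrow> shape \<Rightarrow> complex" where
  "partial_coeff m lam \<delta> = coefficients (marked_shapes m) (A_sum m) (B_mult m (A_sum m lam) (A_sum m \<delta>))"


section \<open>The class sums lie in the two algebras\<close>

lemma map_cyc_comp: "map_cyc f (map_cyc g C) = map_cyc (f \<circ> g) C"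
  by transfer (auto simp: rot_equiv_def intro: exI[of _ 0])

lemma map_cyc_id: "map_cyc id C = C"
  by transfer (auto simp: rot_equiv_def intro: exI[of _ 0])

lemma inj_map_cyc: "inj (map_cyc f)" if "inj f"
  by (rule inj_on_inverseI[of _ "map_cyc (inv f)"]) (simp add: map_cyc_comp that map_cyc_id)

lemma map_cyc_Cyc: "map_cyc f (Cyc w) = Cyc (map f w)"
  by (simp add: map_cyc.abs_eq)

lemma support_conj:
  assumes "bij \<sigma>"
  shows "support (\<sigma> \<circ> \<omega> \<circ> inv \<sigma>) (\<sigma> x) = map \<sigma> (support \<omega> x)"
proof -
  have pow: "((\<sigma> \<circ> \<omega> \<circ> inv \<sigma>) ^^ i) (\<sigma> x) = \<sigma> ((\<omega> ^^ i) x)" for i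
    using assms by (induct i) (auto simp: bij_is_inj)
  have "least_power (\<sigma> \<circ> \<omega> \<circ> inv \<sigma>) (\<sigma> x) = least_power \<omega> x"
    unfolding least_power_def pow using assms by (simp add: bij_is_inj inj_eq)
  then show ?thesis
    by (simp add: pow)
qed

lemma mark_comp:
  assumes "inj \<sigma>" "\<forall>a\<in>{1..m}. \<sigma> a = a"
  shows "mark m \<circ> \<sigma> = mark m"
proof
  fix x
  have iff: "\<sigma> x \<in> {1..m} \<longleftrightarrow> x \<in> {1..m}"
    using assms by (metis injD)
  show "(mark m \<circ> \<sigma>) x = mark m x"
  proof (cases "x \<in> {1..m}")
    case True
    then show ?thesis using assms(2) by simp
  next
    case False
    with iff show ?thesis by (simp only: comp_apply mark_def if_False)
  qed
qed

lemma marked_cycle_type_conj: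
  assumes "bij \<sigma>" "\<forall>a\<in>{1..m}. \<sigma> a = a"
  shows "marked_cycle_type m (\<sigma> ` d) (\<sigma> \<circ> \<omega> \<circ> inv \<sigma>) = marked_cycle_type m d \<omega>"
proof -
  have "cycles_of (\<sigma> ` d) (\<sigma> \<circ> \<omega> \<circ> inv \<sigma>) = map_cyc \<sigma> ` cycles_of d \<omega>"
    by (simp only: cycles_of_def image_image support_conj[OF assms(1)] map_cyc_Cyc)
  moreover have "inj_on (map_cyc \<sigma>) (cycles_of d \<omega>)"
    using inj_map_cyc[OF bij_is_inj[OF assms(1)]] by (rule inj_on_subset) simp
  ultimately have "mset_set (cycles_of (\<sigma> ` d) (\<sigma> \<circ> \<omega> \<circ> inv \<sigma>)) =
      image_mset (map_cyc \<sigma>) (mset_set (cycles_of d \<omega>))"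
    by (simp only: image_mset_mset_set)
  moreover have "map_cyc (mark m) \<circ> map_cyc \<sigma> = map_cyc (mark m)"
    by (rule ext) (simp only: comp_apply map_cyc_comp mark_comp[OF bij_is_inj[OF assms(1)] assms(2)])
  ultimately show ?thesis
    by (simp only: marked_cycle_type_def image_mset.compositionality)
qed

lemma conv_single_left:
  fixes z :: "(nat \<Rightarrow> nat) \<Rightarrow> 'r::comm_ring_1"
  assumes "\<tau> \<in> Sym n" "p \<in> Sym n"
  shows "conv (Sym n) (\<circ>) (single \<tau>) z p = z (inv \<tau> \<circ> p)"
proof -
  have \<tau>: "\<tau> permutes {1..n}" and p: "p permutes {1..n}" using assms by (auto simp: Sym_def)
  have fin: "finite {(x, y). x \<in> Sym n \<and> y \<in> Sym n \<and> x \<circ> y = p}"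
    by (rule finite_subset[of _ "Sym n \<times> Sym n"]) (auto simp: Sym_def finite_permutations)
  have "inv \<tau> \<circ> p \<in> Sym n"
    using \<tau> p by (simp add: Sym_def permutes_compose permutes_inv)
  moreover have "\<tau> \<circ> (inv \<tau> \<circ> p) = p" 
    using \<tau> by (simp add: o_assoc permutes_inv_o)
  moreover have "y = inv \<tau> \<circ> p" if "\<tau> \<circ> y = p" for y
    unfolding that[symmetric] using \<tau> by (simp add: o_assoc permutes_inv_o)
  ultimately have q: "inv \<tau> \<circ> p \<in> Sym n" "\<tau> \<circ> (inv \<tau> \<circ> p) = p"
    "\<And>y. \<tau> \<circ> y = p \<Longrightarrow> y = inv \<tau> \<circ> p" by blast+
  have "conv (Sym n) (\<circ>) (single \<tau>) z p =
     (\<Sum>(x, y) \<in> {(\<tau>, inv \<tau> \<circ> p)}. single \<tau> x * z y)"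
    unfolding conv_def
  proof (rule sum.mono_neutral_right[OF fin])
    show "{(\<tau>, inv \<tau> \<circ> p)} \<subseteq> {(x, y). x \<in> Sym n \<and> y \<in> Sym n \<and> x \<circ> y = p}"
      using q(1,2) assms(1) by simp
    show "\<forall>w\<in>{(x, y). x \<in> Sym n \<and> y \<in> Sym n \<and> x \<circ> y = p} - {(\<tau>, inv \<tau> \<circ> p)}.
        (case w of (x, y) \<Rightarrow> single \<tau> x * z y) = 0"
    proof
      fix w assume w: "w \<in> {(x, y). x \<in> Sym n \<and> y \<in> Sym n \<and> x \<circ> y = p} - {(\<tau>, inv \<tau> \<circ> p)}"
      obtain x y where xy: "w = (x, y)" by force
      have "x \<noteq> \<tau>" using w q(3) unfolding xy by blast
      then show "(case w of (x, y) \<Rightarrow> single \<tau> x * z y) = 0" by (simp add: xy single_def)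
    qed
  qed
  then show ?thesis by (simp add: single_def)
qed

lemma conv_single_right:
  fixes z :: "(nat \<Rightarrow> nat) \<Rightarrow> 'r::comm_ring_1"
  assumes "\<tau> \<in> Sym n" "p \<in> Sym n"
  shows "conv (Sym n) (\<circ>) z (single \<tau>) p = z (p \<circ> inv \<tau>)"
proof -
  have \<tau>: "\<tau> permutes {1..n}" and p: "p permutes {1..n}" using assms by (auto simp: Sym_def)
  have fin: "finite {(x, y). x \<in> Sym n \<and> y \<in> Sym n \<and> x \<circ> y = p}"
    by (rule finite_subset[of _ "Sym n \<times> Sym n"]) (auto simp: Sym_def finite_permutations)
  have "p \<circ> inv \<tau> \<in> Sym n"
    using \<tau> p by (simp add: Sym_def permutes_compose permutes_inv)
  moreover have "(p \<circ> inv \<tau>) \<circ> \<tau> = p" 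
    using \<tau> by (simp add: comp_assoc permutes_inv_o)
  moreover have "y = p \<circ> inv \<tau>" if "y \<circ> \<tau> = p" for y
    unfolding that[symmetric] using \<tau> by (simp add: comp_assoc permutes_inv_o)
  ultimately have q: "p \<circ> inv \<tau> \<in> Sym n" "(p \<circ> inv \<tau>) \<circ> \<tau> = p"
    "\<And>y. y \<circ> \<tau> = p \<Longrightarrow> y = p \<circ> inv \<tau>" by blast+
  have "conv (Sym n) (\<circ>) z (single \<tau>) p =
     (\<Sum>(x, y) \<in> {(p \<circ> inv \<tau>, \<tau>)}. z x * single \<tau> y)"
    unfolding conv_def
  proof (rule sum.mono_neutral_right[OF fin])
    show "{(p \<circ> inv \<tau>, \<tau>)} \<subseteq> {(x, y). x \<in> Sym n \<and> y \<in> Sym n \<and> x \<circ> y = p}"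
      using q(1,2) assms(1) by simp
    show "\<forall>w\<in>{(x, y). x \<in> Sym n \<and> y \<in> Sym n \<and> x \<circ> y = p} - {(p \<circ> inv \<tau>, \<tau>)}.
        (case w of (x, y) \<Rightarrow> z x * single \<tau> y) = 0"
    proof
      fix w assume w: "w \<in> {(x, y). x \<in> Sym n \<and> y \<in> Sym n \<and> x \<circ> y = p} - {(p \<circ> inv \<tau>, \<tau>)}"
      obtain x y where xy: "w = (x, y)" by force
      have "y \<noteq> \<tau>" using w q(3) unfolding xy by blast
      then show "(case w of (x, y) \<Rightarrow> z x * single \<tau> y) = 0" by (simp add: xy single_def)
    qed
  qed
  then show ?thesis by (simp add: single_def)
qed

lemma conv_Sym_outside: "p \<notin> Sym n \<Longrightarrow> conv (Sym n) (\<circ>) f g p = 0"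
proof -
  assume "p \<notin> Sym n"
  then have "{(x, y). x \<in> Sym n \<and> y \<in> Sym n \<and> x \<circ> y = p} = {}"
    by (auto simp: Sym_def permutes_compose)
  then show ?thesis by (simp only: conv_def sum.empty)
qed

lemma centraliser_algebra_iff:
  "z \<in> centraliser_algebra n m \<longleftrightarrow> z \<in> group_ring n \<and>
     (\<forall>\<tau>\<in>Stab n m. \<forall>p\<in>Sym n. z (\<tau> \<circ> p \<circ> inv \<tau>) = z p)"
proof -
  have "(group_ring_mult n (single \<tau>) z = group_ring_mult n z (single \<tau>)) \<longleftrightarrow>
    (\<forall>p\<in>Sym n. z (\<tau> \<circ> p \<circ> inv \<tau>) = z p)" if "\<tau> \<in> Stab n m" for \<tau>
  proof -
    have \<tau>S: "\<tau> \<in> Sym n" and \<tau>: "\<tau> permutes {1..n}" using that by (auto simp: Stab_def Sym_def)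
    have "(group_ring_mult n (single \<tau>) z = group_ring_mult n z (single \<tau>)) \<longleftrightarrow>
      (\<forall>p\<in>Sym n. z (inv \<tau> \<circ> p) = z (p \<circ> inv \<tau>))"
    proof
      assume "group_ring_mult n (single \<tau>) z = group_ring_mult n z (single \<tau>)"
      then show "\<forall>p\<in>Sym n. z (inv \<tau> \<circ> p) = z (p \<circ> inv \<tau>)"
        by (metis conv_single_left[OF \<tau>S] conv_single_right[OF \<tau>S])
    next
      assume *: "\<forall>p\<in>Sym n. z (inv \<tau> \<circ> p) = z (p \<circ> inv \<tau>)"
      show "group_ring_mult n (single \<tau>) z = group_ring_mult n z (single \<tau>)"
      proof
        fix p
        show "group_ring_mult n (single \<tau>) z p = group_ring_mult n z (single \<tau>) p"
          using * by (cases "p \<in> Sym n")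
            (simp_all add: conv_Sym_outside conv_single_left[OF \<tau>S] conv_single_right[OF \<tau>S])
      qed
    qed
    also have "\<dots> \<longleftrightarrow> (\<forall>p\<in>Sym n. z (\<tau> \<circ> p \<circ> inv \<tau>) = z p)"
    proof (intro iffI ballI)
      fix p assume *: "\<forall>p\<in>Sym n. z (inv \<tau> \<circ> p) = z (p \<circ> inv \<tau>)" and p: "p \<in> Sym n"
      have "\<tau> \<circ> p \<in> Sym n" using \<tau> p by (simp add: Sym_def permutes_compose)
      moreover have "inv \<tau> \<circ> (\<tau> \<circ> p) = p"
        using \<tau> by (simp add: o_assoc permutes_inv_o)
      ultimately show "z (\<tau> \<circ> p \<circ> inv \<tau>) = z p" using * by metis
    next
      fix p assume *: "\<forall>p\<in>Sym n. z (\<tau> \<circ> p \<circ> inv \<tau>) = z p" and p: "p \<in> Sym n"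
      have "inv \<tau> \<circ> p \<in> Sym n" using \<tau> p by (simp add: Sym_def permutes_compose permutes_inv)
      moreover have "\<tau> \<circ> (inv \<tau> \<circ> p) = p"
        using \<tau> by (simp add: o_assoc permutes_inv_o)
      ultimately show "z (inv \<tau> \<circ> p) = z (p \<circ> inv \<tau>)" using * by metis
    qed
    finally show ?thesis .
  qed
  then show ?thesis unfolding centraliser_algebra_def by blast
qed

lemma K_sum_mem: "K_sum n m lam \<in> centraliser_algebra n m"
  unfolding centraliser_algebra_iff
proof (intro conjI ballI)
  show "K_sum n m lam \<in> group_ring n" by (simp add: K_sum_def formal_sums_def)
  fix \<tau> p assume "\<tau> \<in> Stab n m" and p: "p \<in> Sym n"
  then have \<tau>: "\<tau> permutes {1..n}" "\<forall>a\<in>{1..m}. \<tau> a = a" by (auto simp: Stab_def Sym_def)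
  have "\<tau> \<circ> p \<circ> inv \<tau> \<in> Sym n" using \<tau> p by (simp add: Sym_def permutes_compose permutes_inv)
  moreover have "marked_cycle_type m {1..n} (\<tau> \<circ> p \<circ> inv \<tau>) = marked_cycle_type m {1..n} p"
    using marked_cycle_type_conj[of \<tau> m "{1..n}" p] \<tau> by (simp add: permutes_bij permutes_image)
  ultimately show "K_sum n m lam (\<tau> \<circ> p \<circ> inv \<tau>) = K_sum n m lam p"
    using p by (simp add: K_sum_def)
qed

lemma pp_act_mem:
  assumes "\<sigma> \<in> Stab_nat m" "x \<in> partial_perms m"
  shows "pp_act \<sigma> x \<in> partial_perms m"
proof -
  obtain d \<omega> where x: "x = (d, \<omega>)" by force
  have \<sigma>: "\<sigma> permutes {1..}" "\<forall>a\<in>{1..m}. \<sigma> a = a" using assms(1) by (auto simp: Stab_nat_def)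
  have d: "finite d" "{1..m} \<subseteq> d" "d \<subseteq> {1..}" "\<omega> permutes d" 
    using assms(2) by (auto simp: x partial_perms_def)
  have "{1..m} \<subseteq> \<sigma> ` d" using \<sigma>(2) d(2) by force
  moreover have "\<sigma> ` d \<subseteq> {1..}" using d(3) permutes_image[OF \<sigma>(1)] by blast
  moreover have "(\<sigma> \<circ> \<omega> \<circ> inv \<sigma>) permutes \<sigma> ` d"
    unfolding permutes_def bij_iff[symmetric]
  proof (intro conjI allI impI)
    show "bij (\<sigma> \<circ> \<omega> \<circ> inv \<sigma>)"
      using \<sigma>(1) d(4) by (simp add: bij_comp bij_imp_bij_inv permutes_bij)
    fix y assume "y \<notin> \<sigma> ` d"
    then have "inv \<sigma> y \<notin> d" using permutes_inverses(1)[OF \<sigma>(1)] by (metis imageI)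
    then show "(\<sigma> \<circ> \<omega> \<circ> inv \<sigma>) y = y"
      using d(4) permutes_inverses(1)[OF \<sigma>(1)] by (simp add: permutes_not_in)
  qed
  ultimately show ?thesis using d(1) by (simp add: x pp_act_def partial_perms_def)
qed

lemma A_sum_mem: "A_sum m \<rho> \<in> A_inf m"
proof -
  have "A_sum m \<rho> (pp_act \<sigma> x) = A_sum m \<rho> x" if "\<sigma> \<in> Stab_nat m" "x \<in> partial_perms m" for \<sigma> x
    using pp_act_mem[OF that] that marked_cycle_type_conj[of \<sigma> m "fst x" "snd x"]
    by (cases x) (auto simp: A_sum_def pp_act_def Stab_nat_def permutes_bij)
  then show ?thesis by (auto simp: A_inf_def formal_sums_def A_sum_def)
qed

lemma finite_factorizations:
  assumes "z \<in> partial_perms m"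
  shows "finite {(x, y). x \<in> partial_perms m \<and> y \<in> partial_perms m \<and> pp_mult x y = z}"
proof -
  have "finite (fst z)" using assms by (auto simp: partial_perms_def)
  then have fin: "finite (\<Union>d\<in>Pow (fst z). {d} \<times> {\<omega>. \<omega> permutes d})" (is "finite ?F")
    by (intro finite_UN_I) (auto simp: finite_permutations finite_subset)
  show ?thesis
    by (rule finite_subset[OF _ finite_cartesian_product[OF fin fin]])
       (auto simp: partial_perms_def pp_mult_def)
qed

end

theory Submission
  imports Defs
begin

text \<open>Two (partial) permutations with the same \<open>m\<close>-marked cycle type are conjugate by a
  permutation fixing \<open>[m]\<close>, and every shape is realized; hence both kinds of structure
  coefficients count the factorizations of any fixed element of the given type. If \<open>\<lambda>\<close> is
  proper, a permutation \<open>\<omega>\<close> of \<open>[n]\<close> of type \<open>\<lambda>\<close> padded to size \<open>n\<close> corresponds to the unique partial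
  permutation \<open>(d, \<omega>)\<close> of type \<open>\<lambda>\<close>, where \<open>d\<close> consists of \<open>[m]\<close> and the points moved by \<open>\<omega>\<close>.
  So a factorization of \<open>z\<close> in the symmetric group is a factorization of \<open>(d, z)\<close> for exactly one
  \<open>d \<subseteq> [n]\<close>, the union of the two domains. Such a \<open>d\<close> adds \<open>k\<close> of the \<open>n - |\<rho>|\<close> remaining points to
  the minimal domain of \<open>z\<close>, and then \<open>(d, z)\<close> has type \<open>\<rho>\<^sup>k\<close>.\<close>

section \<open>Cycle types with labelled points\<close>

text \<open>At \<open>f = mark m\<close> this is \<open>marked_cycle_type m\<close>. The arguments
  on it take \<open>d\<close> apart orbit by orbit and use \<open>f\<close> only as a labelling of
  the points.\<close>

definition cycle_type :: "(nat \<Rightarrow> 'a) \<Rightarrow> nat set \<Rightarrow> (nat \<Rightarrow> nat) \<Rightarrow> 'a cyc multiset" where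
  "cycle_type f d p = image_mset (map_cyc f) (mset_set (cycles_of d p))"

section \<open>Orbits read as cyclic words\<close>

lemma letters_Cyc: "letters (Cyc w) = mset w"
  by (simp add: letters.abs_eq)

lemma Cyc_eq_iff: "Cyc v = Cyc w \<longleftrightarrow> (\<exists>k. w = rotate k v)"
  by (simp add: cyc.abs_eq_iff rot_equiv_def)

text \<open>The power \<open>p ^^ k\<close> is injective and commutes with all powers of
  \<open>p\<close>, so the new starting point has the same period and reads the same orbit
  \<open>k\<close> places later.\<close>

lemma support_funpow:
  assumes "permutation p"
  shows "support p ((p ^^ k) x) = rotate k (support p x)"
proof -
  have "inj (p ^^ k)"
    using assms by (simp add: bij_is_inj permutation inj_fn)
  moreover have "(p ^^ i) ((p ^^ k) x) = (p ^^ k) ((p ^^ i) x)" for i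
    by (metis add.commute comp_apply funpow_add)
  ultimately have lp: "least_power p ((p ^^ k) x) = least_power p x"
    by (simp add: least_power_def inj_eq)
  note l = least_power_of_permutation[OF assms, of x]
  show ?thesis
    unfolding lp
  proof (rule nth_equalityI)
    fix i assume "i < length (map (\<lambda>i. (p ^^ i) ((p ^^ k) x)) [0..<least_power p x])"
    then have "i < least_power p x" by simp
    then show "map (\<lambda>i. (p ^^ i) ((p ^^ k) x)) [0..<least_power p x] ! i = rotate k (support p x) ! i"
      using l by (simp add: nth_rotate funpow_mod_eq flip: funpow_add[THEN fun_cong, unfolded comp_apply])
        (simp add: add.commute)
  qed simp
qed

lemma in_support_self: "permutation p \<Longrightarrow> x \<in> set (support p x)"
  using support_set[of p x] by (metis funpow_0 rangeI)

lemma support_in_closed: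
  assumes "p ` d \<subseteq> d" "x \<in> d"
  shows "set (support p x) \<subseteq> d"
proof -
  have "(p ^^ i) x \<in> d" for i
    using assms by (induct i) auto
  then show ?thesis by auto
qed

lemma Cyc_support_eq:
  assumes "permutation p" "y \<in> set (support p x)"
  shows "Cyc (support p y) = Cyc (support p x)"
proof -
  obtain k where "y = (p ^^ k) x" using assms(2) by auto
  then show ?thesis
    by (simp only: support_funpow[OF assms(1)] cyc.abs_eq_iff) 
       (metis equivp_rot_equiv equivp_symp rot_equiv_def)
qed

lemma image_support:
  assumes "permutation p"
  shows "p ` set (support p x) = set (support p x)"
proof -
  \<comment> \<open>Conjugating \<open>p\<close> by itself gives \<open>p\<close> back, so
    \<open>support_conj\<close> applies with \<open>\<sigma> = p\<close>.\<close>
  have "map p (support p x) = support p (p x)"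
    using support_conj[of p p x] assms
    by (simp add: permutation comp_assoc bij_is_surj surj_iff[THEN iffD1])
  also have "\<dots> = rotate 1 (support p x)"
    using support_funpow[OF assms, of 1 x] by simp
  finally show ?thesis by (metis set_map set_rotate)
qed

lemma image_Diff_support:
  assumes "permutation p" "p ` d = d"
  shows "p ` (d - set (support p x)) = d - set (support p x)"
  using assms by (simp only: image_set_diff[OF bij_is_inj] permutation image_support)

text \<open>A finite invariant set is a disjoint union of orbits, so it can be built up from the
  empty set one orbit at a time.\<close>

lemma closed_set_induct [consumes 3, case_names empty cycle]:
  assumes "permutation p" "finite d" "p ` d = d"
    and "P {}"
    and "\<And>x d. \<lbrakk>finite d; p ` d = d; set (support p x) \<inter> d = {}; P d\<rbrakk> \<Longrightarrow> P (set (support p x) \<union> d)"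
  shows "P d"
  using assms(2,3)
proof (induct d rule: finite_psubset_induct)
  case (psubset d)
  show ?case
  proof (cases "d = {}")
    case False
    then obtain x where x: "x \<in> d" by blast
    let ?s = "set (support p x)"
    have "P (d - ?s)"
      using x in_support_self[OF assms(1), of x] image_Diff_support[OF assms(1) psubset(3)]
      by (intro psubset(2)) blast+
    then have "P (?s \<union> (d - ?s))"
      using psubset image_Diff_support[OF assms(1)] by (intro assms(5)) auto
    moreover have "?s \<union> (d - ?s) = d"
      using support_in_closed[of p d x] x psubset by auto
    ultimately show ?thesis by simp
  qed (simp add: assms(4))
qed

section \<open>Additivity of cycle types over invariant sets\<close>

lemma cycles_of_disjoint:
  assumes "permutation p" "p ` d \<subseteq> d" "p ` e \<subseteq> e" "d \<inter> e = {}"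
  shows "cycles_of d p \<inter> cycles_of e p = {}"
proof (rule ccontr)
  assume "cycles_of d p \<inter> cycles_of e p \<noteq> {}"
  then obtain x y where xy: "x \<in> d" "y \<in> e" "Cyc (support p x) = Cyc (support p y)"
    unfolding cycles_of_def by blast
  \<comment> \<open>Rotation keeps the letters, so equal cyclic words come from the same
    orbit.\<close>
  then have "mset (support p x) = mset (support p y)"
    by (metis letters_Cyc)
  then have "set (support p x) = set (support p y)"
    by (metis set_mset_mset)
  then show False
    using support_in_closed[OF assms(2) xy(1)] support_in_closed[OF assms(3) xy(2)] assms(4)
      in_support_self[OF assms(1), of x] by blast
qed

lemma cycle_type_empty: "cycle_type f {} p = {#}"
  by (simp add: cycle_type_def cycles_of_def)

text \<open>\<open>mset_set\<close> counts each cyclic word once, so additivity rests on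
  \<open>d\<close> and \<open>e\<close> sharing no word. Distinct cycles with equal labels stay
  apart because \<open>f\<close> is applied only afterwards.\<close>

lemma cycle_type_Un:
  assumes "permutation p" "finite d" "finite e" "p ` d \<subseteq> d" "p ` e \<subseteq> e" "d \<inter> e = {}"
  shows "cycle_type f (d \<union> e) p = cycle_type f d p + cycle_type f e p"
proof -
  have "cycles_of (d \<union> e) p = cycles_of d p \<union> cycles_of e p"
    by (simp only: cycles_of_def image_Un)
  moreover have "finite (cycles_of d p)" "finite (cycles_of e p)"
    using assms by (auto simp: cycles_of_def)
  ultimately show ?thesis
    using cycles_of_disjoint[OF assms(1,4-6)] by (simp add: cycle_type_def mset_set_Union)
qed

lemma cycle_type_support:
  assumes "permutation p"
  shows "cycle_type f (set (support p x)) p = {#Cyc (map f (support p x))#}"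
proof -
  have "cycles_of (set (support p x)) p = {Cyc (support p x)}"
    unfolding cycles_of_def
    using Cyc_support_eq[OF assms] in_support_self[OF assms, of x] by blast
  then show ?thesis by (simp only: cycle_type_def) (simp add: map_cyc_Cyc)
qed

lemma cycle_type_support_Un:
  assumes "permutation p" "finite d" "p ` d \<subseteq> d" "set (support p x) \<inter> d = {}"
  shows "cycle_type f (set (support p x) \<union> d) p =
    {#Cyc (map f (support p x))#} + cycle_type f d p"
  unfolding cycle_type_support[OF assms(1), symmetric]
  using assms image_support[OF assms(1), of x] by (intro cycle_type_Un) auto

lemma cycle_type_cong:
  assumes "p ` d \<subseteq> d" "\<And>x. x \<in> d \<Longrightarrow> p x = q x"
  shows "cycle_type f d p = cycle_type f d q"
proof -
  have "(p ^^ i) x = (q ^^ i) x \<and> (p ^^ i) x \<in> d" if "x \<in> d" for x i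
    using assms that by (induct i) auto
  then have "support p x = support q x" if "x \<in> d" for x
    using that by (simp add: least_power_def)
  then show ?thesis
    by (simp add: cycle_type_def cycles_of_def)
qed

text \<open>Orbit words have no repetitions and the orbits partition \<open>d\<close>, so every
  point contributes its label exactly once. This fixes the size and the marks of a cycle
  type.\<close>

lemma letters_cycle_type:
  assumes "permutation p" "finite d" "p ` d = d"
  shows "(\<Sum>C\<in>#cycle_type f d p. letters C) = image_mset f (mset_set d)"
  using assms
proof (induct rule: closed_set_induct)
  case empty
  then show ?case by (simp add: cycle_type_empty)
next
  case (cycle x d)
  have "mset (support p x) = mset_set (set (support p x))"
    using cycle_of_permutation[OF assms(1), of x] by (metis mset_set_set)
  moreover have "mset_set (set (support p x) \<union> d) = mset_set (set (support p x)) + mset_set d"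
    using cycle by (intro mset_set_Union) auto
  moreover have "cycle_type f (set (support p x) \<union> d) p =
    {#Cyc (map f (support p x))#} + cycle_type f d p"
    using cycle by (intro cycle_type_support_Un assms(1)) auto
  ultimately show ?case
    using cycle by (simp only: image_mset_union sum_mset.union
      image_mset_single sum_mset.singleton letters_Cyc mset_map)
qed

lemma letters_nonempty_cycle_type:
  assumes "permutation p" "finite d" "C \<in># cycle_type f d p"
  shows "letters C \<noteq> {#}"
proof -
  have "finite (cycles_of d p)" using assms(2) by (simp add: cycles_of_def)
  with assms(3) obtain x where "C = Cyc (map f (support p x))"
    by (auto simp only: cycle_type_def cycles_of_def set_image_mset finite_set_mset_mset_set map_cyc_Cyc)
  then show ?thesis
    using in_support_self[OF assms(1), of x] by (metis letters_Cyc list.set(1) list.map_disc_iff mset_zero_iff empty_iff)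
qed

text \<open>The result is an equality of words, not of cyclic words: a rotation is absorbed by
  another starting point on the same orbit.\<close>

lemma cycle_typeE:
  assumes "permutation p" "finite d" "p ` d \<subseteq> d" "Cyc w \<in># cycle_type f d p"
  obtains x where "x \<in> d" "w = map f (support p x)"
proof -
  have "finite (cycles_of d p)" using assms(2) by (simp add: cycles_of_def)
  with assms(4) obtain x where x: "x \<in> d" "Cyc w = Cyc (map f (support p x))"
    by (auto simp only: cycle_type_def cycles_of_def set_image_mset finite_set_mset_mset_set map_cyc_Cyc)
  then obtain k where "w = rotate k (map f (support p x))"
    by (metis Cyc_eq_iff)
  then have "w = map f (support p ((p ^^ k) x))"
    by (simp only: support_funpow[OF assms(1)] rotate_map)
  moreover have "(p ^^ k) x \<in> d"
    using x(1) assms(3) by (induct k) auto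
  ultimately show thesis
    using that by blast
qed


section \<open>Equal cycle types force conjugacy\<close>

lemma cycle_type_eq_empty_iff:
  assumes "finite d"
  shows "cycle_type f d p = {#} \<longleftrightarrow> d = {}"
  using assms by (simp add: cycle_type_def cycles_of_def mset_set_empty_iff)

lemma support_eq_nth:
  assumes "permutation p" "i < length (support p x)"
  shows "p (support p x ! i) = support p x ! (Suc i mod length (support p x))"
proof -
  note l = least_power_of_permutation[OF assms(1), of x]
  have "(p ^^ (Suc i mod least_power p x)) x = (p ^^ Suc i) x"
    using l(1) by (rule funpow_mod_eq)
  then show ?thesis
    using assms(2) l(2) by simp
qed

lemma bij_betw_set_of_map_eq:
  assumes "distinct xs" "distinct ys" "map f xs = map f ys"
  shows "\<exists>h. bij_betw h (set xs) (set ys) \<and> (\<forall>i<length xs. h (xs ! i) = ys ! i) \<and>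
    (\<forall>x\<in>set xs. f (h x) = f x)"
proof -
  define h where "h z = the (map_of (zip xs ys) z)" for z
  have len: "length xs = length ys"
    using assms(3) by (rule map_eq_imp_length_eq)
  have h: "h (xs ! i) = ys ! i" if "i < length xs" for i
    using that assms(1) len unfolding h_def by (metis map_of_zip_nth option.sel)
  have map: "map h xs = ys"
    using h len by (intro nth_equalityI) auto
  have "bij_betw h (set xs) (set ys)"
    using assms(1,2) map by (metis bij_betw_def distinct_map set_map)
  moreover have "map (f \<circ> h) xs = map f xs"
    using map assms(3) by (simp flip: map_map)
  ultimately show ?thesis using h by auto
qed

text \<open>Orbits of \<open>p\<close> and \<open>q\<close> with the same label word are matched
  position by position, and the induction matches the rest; \<open>e\<close> is arbitrary because it
  loses an orbit of \<open>q\<close> at each step.\<close>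

lemma cycle_type_eq_imp_conj:
  assumes p: "permutation p" "finite d" "p ` d = d"
    and q: "permutation q" "finite e" "q ` e = e"
    and eq: "cycle_type f d p = cycle_type f e q"
  shows "\<exists>g. bij_betw g d e \<and> (\<forall>x\<in>d. f (g x) = f x \<and> g (p x) = q (g x))"
  using p q(2-) eq
proof (induct arbitrary: e rule: closed_set_induct)
  case empty
  then have "e = {}" by (metis cycle_type_empty cycle_type_eq_empty_iff)
  then show ?case by (simp add: bij_betw_def)
next
  case (cycle x d)
  let ?s = "support p x"
  have *: "cycle_type f (set ?s \<union> d) p = {#Cyc (map f ?s)#} + cycle_type f d p"
    using cycle by (intro cycle_type_support_Un p(1)) auto
  moreover have "Cyc (map f ?s) \<in># {#Cyc (map f ?s)#} + cycle_type f d p"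
    by simp
  ultimately have "Cyc (map f ?s) \<in># cycle_type f e q"
    using cycle(7) by metis
  then obtain y where y: "y \<in> e" "map f ?s = map f (support q y)"
    using cycle_typeE[OF q(1) cycle(5)] cycle(6) by blast
  let ?t = "support q y"
  have e: "set ?t \<union> (e - set ?t) = e"
    using support_in_closed[of q e y] cycle(6) y(1) by auto
  \<comment> \<open>Two expressions for the type of \<open>e\<close> with the same leading cycle;
    cancelling it gives the equality of types needed by the induction hypothesis.\<close>
  have 1: "cycle_type f e q = {#Cyc (map f ?t)#} + cycle_type f d p"
    by (simp only: cycle(7)[symmetric] * y(2))
  have "cycle_type f (set ?t \<union> (e - set ?t)) q = {#Cyc (map f ?t)#} + cycle_type f (e - set ?t) q"
    using cycle(5) image_Diff_support[OF q(1) cycle(6)] by (intro cycle_type_support_Un q(1)) auto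
  then have 2: "cycle_type f e q = {#Cyc (map f ?t)#} + cycle_type f (e - set ?t) q"
    by (simp only: e)
  have "cycle_type f d p = cycle_type f (e - set ?t) q"
    by (rule add_left_imp_eq[OF trans[OF sym[OF 1] 2]])
  then obtain g where g: "bij_betw g d (e - set ?t)" "\<forall>x\<in>d. f (g x) = f x \<and> g (p x) = q (g x)"
    using cycle(4)[of "e - set ?t"] cycle(5) image_Diff_support[OF q(1) cycle(6)] by auto
  have dist: "distinct ?s" "distinct ?t"
    using cycle_of_permutation[OF p(1)] cycle_of_permutation[OF q(1)] by blast+
  obtain h where h: "bij_betw h (set ?s) (set ?t)" "\<And>i. i < length ?s \<Longrightarrow> h (?s ! i) = ?t ! i"
    "\<And>z. z \<in> set ?s \<Longrightarrow> f (h z) = f z"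
    using bij_betw_set_of_map_eq[OF dist y(2)] by blast
  have len: "length ?s = length ?t"
    using map_eq_imp_length_eq[OF y(2)] .
  have hp: "f (h z) = f z \<and> h (p z) = q (h z)" if z: "z \<in> set ?s" for z
  proof
    obtain i where i: "i < length ?s" "?s ! i = z"
      using z unfolding in_set_conv_nth by blast
    \<comment> \<open>Each permutation advances by one position along its word, and since both words
      have the same length the wrap-around at the end agrees.\<close>
    have lt: "Suc i mod length ?s < length ?s" using i(1) by (intro mod_less_divisor) linarith
    have "h (p (?s ! i)) = ?t ! (Suc i mod length ?t)"
      using h(2)[OF lt] unfolding support_eq_nth[OF p(1) i(1)] len .
    also have "\<dots> = q (h (?s ! i))"
      unfolding h(2)[OF i(1)] using i(1) unfolding len by (rule support_eq_nth[OF q(1), symmetric])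
    finally show "h (p z) = q (h z)" by (simp only: i(2))
  qed (rule h(3)[OF z])
  define k where "k z = (if z \<in> set ?s then h z else g z)" for z
  have k: "k z = g z" if "z \<in> d" for z
  proof -
    have "z \<notin> set ?s" using that cycle(3) by blast
    then show ?thesis by (simp only: k_def if_False)
  qed
  have "bij_betw k (set ?s) (set ?t)"
    using h(1) by (rule bij_betw_cong[THEN iffD1, rotated]) (simp only: k_def if_True)
  moreover have "bij_betw k d (e - set ?t)"
    using g(1) by (rule bij_betw_cong[THEN iffD1, rotated]) (simp only: k)
  ultimately have "bij_betw k (set ?s \<union> d) (set ?t \<union> (e - set ?t))"
    by (rule bij_betw_combine) blast
  moreover have "f (k z) = f z \<and> k (p z) = q (k z)" if "z \<in> set ?s \<union> d" for z
  proof (cases "z \<in> set ?s")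
    case True
    moreover from this have "p z \<in> set ?s" using image_support[OF p(1), of x] by blast
    ultimately show ?thesis using hp[of z] by (simp only: k_def if_True)
  next
    case False
    then have "z \<in> d" "p z \<in> d" "p z \<notin> set ?s" using that cycle(2,3) by blast+
    then show ?thesis using g(2) by (simp only: k)
  qed
  ultimately show ?case
    unfolding e by (intro exI[of _ k]) blast
qed

section \<open>Realizing a given cycle type\<close>

lemma support_cycle_of_list:
  assumes "distinct xs" "xs \<noteq> []"
  shows "support (cycle_of_list xs) (hd xs) = xs"
proof -
  let ?c = "cycle_of_list xs"
  \<comment> \<open>By \<open>cyclic_rotation\<close>, \<open>i\<close> applications of the cycle
    rotate \<open>xs\<close> by \<open>i\<close>; comparing first entries gives this.\<close>
  have pow: "(?c ^^ i) (hd xs) = xs ! (i mod length xs)" for i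
    using arg_cong[OF cyclic_rotation[OF assms(1), of i], of hd] assms(2)
    by (simp add: hd_map hd_rotate_conv_nth)
  have "least_power ?c (hd xs) = length xs"
    unfolding least_power_def
  proof (rule Least_equality)
    show "(?c ^^ length xs) (hd xs) = hd xs \<and> 0 < length xs"
      using assms(2) pow[of "length xs"] by (simp add: hd_conv_nth)
    fix k assume "(?c ^^ k) (hd xs) = hd xs \<and> 0 < k"
    then have "xs ! (k mod length xs) = xs ! 0" "0 < k"
      using assms(2) pow[of k] by (simp_all add: hd_conv_nth)
    then have "k mod length xs = 0"
      using assms by (simp add: nth_eq_iff_index_eq)
    with \<open>0 < k\<close> show "length xs \<le> k" by (simp add: dvd_imp_le mod_0_imp_dvd)
  qed
  then show ?thesis
    by (intro nth_equalityI) (simp_all add: pow)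
qed

lemma mset_map_split:
  assumes "image_mset f A = mset w"
  shows "\<exists>xs. mset xs = A \<and> map f xs = w"
  using assms
proof (induct w arbitrary: A)
  case (Cons a w)
  then obtain B b where "A = add_mset b B" "f b = a" "image_mset f B = mset w"
    by (metis msed_map_invR mset.simps(2))
  moreover from Cons(1)[OF this(3)] obtain xs where "mset xs = B" "map f xs = w" by blast
  ultimately show ?case by (intro exI[of _ "b # xs"]) auto
qed simp

text \<open>The labels needed by the cycles of \<open>M\<close> are exactly those available on
  \<open>d\<close>, so points can be set aside for one cycle and the rest handled by
  induction.\<close>

lemma cycle_type_realizable:
  assumes "finite d" "\<forall>C\<in>#M. letters C \<noteq> {#}"
    and "(\<Sum>C\<in>#M. letters C) = image_mset f (mset_set d)"
  shows "\<exists>p. p permutes d \<and> cycle_type f d p = M"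
  using assms
proof (induct M arbitrary: d)
  case empty
  then show ?case
    by (auto simp: cycle_type_empty mset_set_empty_iff intro!: exI[of _ id])
next
  case (add C M)
  obtain w where w: "C = Cyc w" by (metis Quotient3_abs_rep Quotient3_cyc)
  have "image_mset f (mset_set d) = mset w + (\<Sum>C\<in>#M. letters C)"
    using add(4) by (simp add: w letters_Cyc)
  \<comment> \<open>A splitting of the labels lifts to one of the points: \<open>A\<close> carries
    the letters of \<open>w\<close>, \<open>B\<close> those of the remaining cycles.\<close>
  then obtain A B where AB: "mset_set d = A + B" "mset w = image_mset f A"
    "(\<Sum>C\<in>#M. letters C) = image_mset f B"
    using image_mset_eq_plusD by metis
  define a b where "a = set_mset A" and "b = set_mset B"
  have d: "d = a \<union> b" 
    using arg_cong[OF AB(1), of set_mset] add(2) by (simp add: a_def b_def)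
  \<comment> \<open>Since \<open>d\<close> is a set, no point has multiplicity above one, which
    makes \<open>A\<close> and \<open>B\<close> the multisets of two disjoint sets.\<close>
  have cnt: "count A x + count B x = (if x \<in> d then 1 else 0)" for x
    using arg_cong[OF AB(1), of "\<lambda>M. count M x"] add(2) by (simp add: count_mset_set')
  then have le: "count A x + count B x \<le> 1" for x by simp
  have fin: "finite a" "finite b" by (simp_all add: a_def b_def)
  have disj: "a \<inter> b = {}"
  proof -
    have False if "x \<in># A" "x \<in># B" for x
      using le[of x] that by (simp flip: count_greater_zero_iff)
    then show ?thesis by (auto simp: a_def b_def)
  qed
  have A: "A = mset_set a" and B: "B = mset_set b"
    unfolding a_def b_def using le
    by (intro multiset_eqI; simp add: count_mset_set' not_in_iff; metis Suc_leI add_leE count_greater_zero_iff le_antisym One_nat_def)+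
  obtain xs where xs: "mset xs = A" "map f xs = w"
    using mset_map_split[of f A w] AB(2) by metis
  have set: "set xs = a"
    using xs(1) by (metis a_def set_mset_mset)
  then have dist: "distinct xs"
    using xs(1) A fin by (simp add: distinct_count_atmost_1 count_mset_set')
  have "xs \<noteq> []" using add(3) w xs(2) by (auto simp: letters_Cyc)
  obtain q where q: "q permutes b" "cycle_type f b q = M"
    using add(1)[of b] add(3) AB(3) B fin by auto
  \<comment> \<open>\<open>c\<close> runs through the points set aside for \<open>w\<close> in the
    order of \<open>xs\<close>. It is the identity on \<open>b\<close>, so composing it with
    \<open>q\<close> disturbs neither.\<close>
  define c where "c = cycle_of_list xs"
  have c: "c permutes a" using cycle_permutes[of xs] by (simp add: c_def set)
  have perm: "c \<circ> q permutes d"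
    unfolding d by (intro permutes_compose permutes_subset[OF q(1)] permutes_subset[OF c]) auto
  have cq: "(c \<circ> q) x = c x" if "x \<in> a" for x
    using that disj permutes_not_in[OF q(1), of x] by (simp add: disjoint_iff)
  have qc: "(c \<circ> q) x = q x" if "x \<in> b" for x
    using that disj permutes_in_image[OF q(1), of x] permutes_not_in[OF c, of "q x"]
    by (auto simp: disjoint_iff)
  have ca: "c ` a = a" "q ` b = b" using permutes_image[OF c] permutes_image[OF q(1)] by auto
  have im: "(c \<circ> q) ` a = a" "(c \<circ> q) ` b = b"
    using cq qc ca by (metis image_cong)+
  have "permutation (c \<circ> q)"
    using perm add(2) by (auto simp: permutation_permutes)
  then have "cycle_type f d (c \<circ> q) = cycle_type f a (c \<circ> q) + cycle_type f b (c \<circ> q)"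
    unfolding d
    using fin disj im by (intro cycle_type_Un) auto
  also have "cycle_type f b (c \<circ> q) = M"
    using cycle_type_cong[of "c \<circ> q" b q f] im qc q(2) by simp
  also have "cycle_type f a (c \<circ> q) = cycle_type f a c"
    using im cq by (intro cycle_type_cong) auto
  also have "\<dots> = {#C#}"
    using cycle_type_support[OF permutation_of_cycle, of f xs "hd xs"]
    by (simp only: support_cycle_of_list[OF dist \<open>xs \<noteq> []\<close>] set xs(2) w c_def)
  finally show ?case using perm by auto
qed

section \<open>Marked cycle types\<close>

lemma marked_cycle_type_eq: "marked_cycle_type m = cycle_type (mark m)"
  by (intro ext) (simp add: marked_cycle_type_def cycle_type_def)

section \<open>Letters and sizes of marked cycle types\<close>

lemma count_mark_None:
  assumes "finite d" "{1..m} \<subseteq> d"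
  shows "count (image_mset (mark m) (mset_set d)) None = card d - m"
proof -
  have "{x \<in> d. mark m x = None} = d - {1..m}" by (auto simp: mark_def)
  then have "count (image_mset (mark m) (mset_set d)) None = card (d - {1..m})"
    using assms(1) by (simp add: count_image_mset_eq_card_vimage)
  then show ?thesis
    using assms by (simp add: card_Diff_subset)
qed

lemma count_mark_Some:
  assumes "finite d" "{1..m} \<subseteq> d"
  shows "count (image_mset (mark m) (mset_set d)) (Some a) = (if a \<in> {1..m} then 1 else 0)"
proof -
  have "{x \<in> d. mark m x = Some a} = (if a \<in> {1..m} then {a} else {})"
    using assms(2) by (auto simp: mark_def)
  then show ?thesis
    using assms(1) by (simp add: count_image_mset_eq_card_vimage)
qed

text \<open>The definition of a shape leaves only the number of letters \<open>None\<close> open,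
  and the size fixes it. Hence any \<open>d\<close> of the right size supplies the letters needed
  for realization.\<close>

lemma all_letters_marked_shape:
  assumes "\<rho> \<in> marked_shapes m" "finite d" "{1..m} \<subseteq> d" "card d = shape_size m \<rho>"
  shows "all_letters \<rho> = image_mset (mark m) (mset_set d)"
proof (rule multiset_eqI)
  fix l
  show "count (all_letters \<rho>) l = count (image_mset (mark m) (mset_set d)) l"
  proof (cases l)
    case None
    then show ?thesis
      using count_mark_None[OF assms(2,3)] assms(4) by (simp add: shape_size_def)
  next
    case (Some a)
    have "Some a \<in># all_letters \<rho> \<Longrightarrow> a \<in> {1..m}"
      using assms(1) by (auto simp: marked_shapes_def)
    then show ?thesis
      using count_mark_Some[OF assms(2,3), of a] assms(1)
      by (auto simp: marked_shapes_def Some not_in_iff)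
  qed
qed

lemma all_letters_marked_cycle_type:
  assumes "finite d" "p permutes d"
  shows "all_letters (marked_cycle_type m d p) = image_mset (mark m) (mset_set d)"
  using letters_cycle_type[of p d "mark m"] assms permutes_image[OF assms(2)]
  by (auto simp: all_letters_def marked_cycle_type_eq permutation_permutes)

lemma shape_size_marked_cycle_type:
  assumes "finite d" "{1..m} \<subseteq> d" "p permutes d"
  shows "shape_size m (marked_cycle_type m d p) = card d"
  using count_mark_None[OF assms(1,2)] card_mono[OF assms(1,2)] assms
  by (simp add: shape_size_def all_letters_marked_cycle_type)

lemma marked_cycle_type_in_marked_shapes:
  assumes "finite d" "{1..m} \<subseteq> d" "p permutes d"
  shows "marked_cycle_type m d p \<in> marked_shapes m"
proof -
  have "permutation p" using assms(1,3) by (auto simp: permutation_permutes)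
  then have "letters C \<noteq> {#}" if "C \<in># marked_cycle_type m d p" for C
    using letters_nonempty_cycle_type[of p d C "mark m"] assms(1) that
    by (simp add: marked_cycle_type_eq)
  then show ?thesis
    using count_mark_Some[OF assms(1,2)] assms
    by (auto simp: marked_shapes_def all_letters_marked_cycle_type mark_def)
qed

lemma marked_shape_realizable:
  assumes "\<rho> \<in> marked_shapes m" "finite d" "{1..m} \<subseteq> d" "card d = shape_size m \<rho>"
  shows "\<exists>p. p permutes d \<and> marked_cycle_type m d p = \<rho>"
  using cycle_type_realizable[OF assms(2), of \<rho> "mark m"] all_letters_marked_shape[OF assms] assms(1)
  by (simp add: marked_shapes_def all_letters_def marked_cycle_type_eq)

text \<open>Presents the index set as the image of the type map, the form required by
  \<open>coefficients_fibre\<close>.\<close>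

lemma marked_shapes_of_size_eq:
  assumes "m \<le> n"
  shows "marked_shapes_of_size m n = marked_cycle_type m {1..n} ` Sym n"
proof -
  have n: "finite {1..n}" "{1..m} \<subseteq> {1..n}" "card {1..n} = n" using assms by auto
  show ?thesis
  proof (intro equalityI subsetI)
    fix \<rho> assume "\<rho> \<in> marked_shapes_of_size m n"
    then show "\<rho> \<in> marked_cycle_type m {1..n} ` Sym n"
      using marked_shape_realizable[of \<rho> m "{1..n}"] n
      unfolding marked_shapes_of_size_def Sym_def by (metis (mono_tags, lifting) imageI mem_Collect_eq)
  next
    fix \<rho> assume "\<rho> \<in> marked_cycle_type m {1..n} ` Sym n"
    then show "\<rho> \<in> marked_shapes_of_size m n"
      using marked_cycle_type_in_marked_shapes[OF n(1,2)] shape_size_marked_cycle_type[OF n(1,2)] n(3)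
      by (auto simp only: marked_shapes_of_size_def Sym_def)
  qed
qed

definition pp_type :: "nat \<Rightarrow> partial_perm \<Rightarrow> shape" where
  "pp_type m x = marked_cycle_type m (fst x) (snd x)"

lemma marked_shapes_eq: "marked_shapes m = pp_type m ` partial_perms m"
proof (intro equalityI subsetI)
  fix \<rho> assume \<rho>: "\<rho> \<in> marked_shapes m"
  \<comment> \<open>This interval contains \<open>{1..m}\<close> because
    \<open>shape_size m \<rho>\<close> is at least \<open>m\<close>.\<close>
  let ?d = "{1..shape_size m \<rho>}"
  have "{1..m} \<subseteq> ?d" by (auto simp: shape_size_def)
  moreover from this obtain p where "p permutes ?d" "marked_cycle_type m ?d p = \<rho>"
    using marked_shape_realizable[OF \<rho>, of ?d] by auto
  ultimately show "\<rho> \<in> pp_type m ` partial_perms m"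
    by (intro image_eqI[of _ _ "(?d, p)"]) (auto simp: pp_type_def partial_perms_def)
qed (auto simp: pp_type_def partial_perms_def intro!: marked_cycle_type_in_marked_shapes)

section \<open>Conjugacy of partial permutations\<close>

lemma bij_betw_extend_permutes:
  assumes "bij_betw g d e" "finite d"
  shows "\<exists>h. h permutes (d \<union> e) \<and> (\<forall>x\<in>d. h x = g x)"
proof -
  have "finite e" using assms bij_betw_finite by blast
  have "card d = card e" using assms(1) by (rule bij_betw_same_card)
  \<comment> \<open>The points of \<open>e - d\<close> can be sent back to \<open>d - e\<close>,
    which closes \<open>g\<close> up to a permutation of the union.\<close>
  then have "card (e - d) = card (d - e)"
    using assms(2) \<open>finite e\<close> by (simp add: card_Diff_subset_Int Int_commute)
  then obtain k where k: "bij_betw k (e - d) (d - e)"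
    using assms(2) \<open>finite e\<close> by (meson finite_Diff finite_same_card_bij)
  define h where "h x = (if x \<in> d then g x else if x \<in> e then k x else x)" for x
  have "bij_betw h d e"
    using assms(1) by (rule bij_betw_cong[THEN iffD1, rotated]) (simp add: h_def)
  moreover have "bij_betw h (e - d) (d - e)"
    using k by (rule bij_betw_cong[THEN iffD1, rotated]) (simp add: h_def)
  ultimately have "bij_betw h (d \<union> (e - d)) (e \<union> (d - e))"
    by (rule bij_betw_combine) blast
  then have "bij_betw h (d \<union> e) (d \<union> e)"
    by (simp add: Un_commute)
  then have "h permutes (d \<union> e)"
    by (rule bij_imp_permutes) (simp add: h_def)
  then show ?thesis by (auto simp: h_def)
qed

text \<open>The conjugating bijection of the domains extends to a permutation of their union.
  Confining \<open>\<sigma>\<close> there makes it finitely supported, and an element of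
  \<open>Sym n\<close> when both domains are \<open>{1..n}\<close>.\<close>

lemma pp_type_eq_imp_conj:
  assumes "x \<in> partial_perms m" "y \<in> partial_perms m" "pp_type m x = pp_type m y"
  shows "\<exists>\<sigma>. \<sigma> permutes (fst x \<union> fst y) \<and> (\<forall>a\<in>{1..m}. \<sigma> a = a) \<and> pp_act \<sigma> x = y"
proof -
  obtain d p e q where xy: "x = (d, p)" "y = (e, q)" by force
  have d: "finite d" "{1..m} \<subseteq> d" "p permutes d" and e: "finite e" "{1..m} \<subseteq> e" "q permutes e"
    using assms(1,2) by (auto simp: xy partial_perms_def)
  have "permutation p" "permutation q" using d e by (auto simp: permutation_permutes)
  then obtain g where g: "bij_betw g d e" "\<forall>x\<in>d. mark m (g x) = mark m x \<and> g (p x) = q (g x)"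
    using cycle_type_eq_imp_conj[of p d q e "mark m"] d(1) e(1) assms(3)
      permutes_image[OF d(3)] permutes_image[OF e(3)]
    by (auto simp: pp_type_def xy marked_cycle_type_eq)
  obtain \<sigma> where \<sigma>: "\<sigma> permutes (d \<union> e)" "\<forall>x\<in>d. \<sigma> x = g x"
    using bij_betw_extend_permutes[OF g(1) d(1)] by blast
  have "\<sigma> a = a" if "a \<in> {1..m}" for a
  proof -
    \<comment> \<open>\<open>g\<close> preserves labels, and \<open>a\<close> is the only point
      labelled \<open>Some a\<close>.\<close>
    have "mark m (\<sigma> a) = Some a"
      using that d(2) g(2) \<sigma>(2) by (simp add: mark_def[of m a] subset_eq)
    then show ?thesis by (simp add: mark_def del: atLeastAtMost_iff split: if_splits)
  qed
  moreover have im: "\<sigma> ` d = e"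
    using g(1) \<sigma>(2) by (simp add: bij_betw_def)
  moreover have "\<sigma> (p a) = q (\<sigma> a)" for a
  proof (cases "a \<in> d")
    case True
    then show ?thesis using g(2) \<sigma>(2) permutes_in_image[OF d(3)] by simp
  next
    case False
    \<comment> \<open>\<open>\<sigma>\<close> maps the complement of \<open>d\<close> outside
      \<open>e\<close>, where \<open>q\<close> is the identity, as \<open>p\<close> is off
      \<open>d\<close>.\<close>
    then have "\<sigma> a \<notin> e"
      using im permutes_inj[OF \<sigma>(1)] by (metis imageE injD)
    then show ?thesis using False d(3) e(3) by (simp add: permutes_not_in)
  qed
  then have "\<sigma> \<circ> p \<circ> inv \<sigma> = q"
    using permutes_inverses[OF \<sigma>(1)] by (simp add: fun_eq_iff)
  ultimately show ?thesis using \<sigma>(1) by (auto simp: xy pp_act_def)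
qed

section \<open>Structure coefficients as numbers of factorizations\<close>

text \<open>The \<open>b i\<close> are the indicators of the fibres of \<open>t\<close>, so
  expanding \<open>v\<close> means recording its constant value on each fibre. Every index in
  \<open>I\<close> is attained, so these values are unique and the \<open>THE\<close> in
  \<open>coefficients\<close> is well defined.\<close>

lemma coefficients_fibre:
  fixes v :: "'x \<Rightarrow> 'r::comm_ring_1"
  assumes b: "\<And>i x. b i x = (if x \<in> S \<and> t x = i then 1 else 0)"
    and I: "I = t ` S"
    and off: "\<And>x. x \<notin> S \<Longrightarrow> v x = 0"
    and const: "\<And>x y. x \<in> S \<Longrightarrow> y \<in> S \<Longrightarrow> t x = t y \<Longrightarrow> v x = v y"
    and x: "x \<in> S"
  shows "coefficients I b v (t x) = v x"
proof -
  have lc: "lin_comb I b c y = (if y \<in> S then c (t y) else 0)" for c y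
  proof -
    have "{i \<in> I. b i y \<noteq> 0} = (if y \<in> S then {t y} else {})"
      by (auto simp: b I)
    then show ?thesis unfolding lin_comb_def by (simp only:) (simp add: b)
  qed
  \<comment> \<open>\<open>SOME\<close> picks a point of the fibre; the value \<open>0\<close> off
    \<open>I\<close> is the normalization demanded by \<open>coefficients\<close>.\<close>
  define c where "c i = (if i \<in> I then v (SOME y. y \<in> S \<and> t y = i) else 0)" for i
  have c: "c (t y) = v y" if "y \<in> S" for y
  proof -
    have "(SOME z. z \<in> S \<and> t z = t y) \<in> S \<and> t (SOME z. z \<in> S \<and> t z = t y) = t y"
      using someI[where P = "\<lambda>z. z \<in> S \<and> t z = t y", of y] that by blast
    then have "v (SOME z. z \<in> S \<and> t z = t y) = v y" using const[OF _ that] by blast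
    then show ?thesis using that by (simp add: c_def I)
  qed
  have "coefficients I b v = c"
    unfolding coefficients_def
  proof (rule the_equality)
    show "(\<forall>i. i \<notin> I \<longrightarrow> c i = 0) \<and> v = lin_comb I b c"
      using off c by (auto simp: c_def lc fun_eq_iff)
    fix c' assume c': "(\<forall>i. i \<notin> I \<longrightarrow> c' i = 0) \<and> v = lin_comb I b c'"
    then have "c' (t y) = c (t y)" if "y \<in> S" for y
      using that c lc[of c' y] by simp
    then show "c' = c"
      using c' by (auto simp: fun_eq_iff I c_def)
  qed
  then show ?thesis using c[OF x] by simp
qed

lemma conv_indicators:
  assumes "finite {(x, y). x \<in> S \<and> y \<in> S \<and> mul x y = z}"
  shows "conv S mul (\<lambda>x. if P x then 1 else 0) (\<lambda>y. if Q y then 1 else 0) z =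
    of_nat (card {(x, y). x \<in> S \<and> y \<in> S \<and> mul x y = z \<and> P x \<and> Q y})"
proof -
  let ?F = "{(x, y). x \<in> S \<and> y \<in> S \<and> mul x y = z}"
  have "conv S mul (\<lambda>x. if P x then 1 else 0) (\<lambda>y. if Q y then 1 else 0) z =
    (\<Sum>w\<in>?F. if P (fst w) \<and> Q (snd w) then 1 else 0)"
    unfolding conv_def by (intro sum.cong) auto
  also have "\<dots> = of_nat (card (?F \<inter> {w. P (fst w) \<and> Q (snd w)}))"
    using assms by (simp add: sum.If_cases)
  also have "?F \<inter> {w. P (fst w) \<and> Q (snd w)} = {(x, y). x \<in> S \<and> y \<in> S \<and> mul x y = z \<and> P x \<and> Q y}"
    by auto
  finally show ?thesis .
qed

section \<open>Sets of factorizations and their invariance under conjugation\<close>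

definition pp_factors :: "nat \<Rightarrow> shape \<Rightarrow> shape \<Rightarrow> partial_perm \<Rightarrow> (partial_perm \<times> partial_perm) set" where
  "pp_factors m lam \<delta> z = {(x, y). x \<in> partial_perms m \<and> y \<in> partial_perms m \<and>
     pp_mult x y = z \<and> pp_type m x = lam \<and> pp_type m y = \<delta>}"

definition Sym_factors ::
  "nat \<Rightarrow> nat \<Rightarrow> shape \<Rightarrow> shape \<Rightarrow> (nat \<Rightarrow> nat) \<Rightarrow> ((nat \<Rightarrow> nat) \<times> (nat \<Rightarrow> nat)) set" where
  "Sym_factors n m lam \<delta> z = {(x, y). x \<in> Sym n \<and> y \<in> Sym n \<and> x \<circ> y = z \<and>
     marked_cycle_type m {1..n} x = lam \<and> marked_cycle_type m {1..n} y = \<delta>}"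

lemma finite_pp_factors:
  assumes "z \<in> partial_perms m"
  shows "finite (pp_factors m lam \<delta> z)"
  by (rule finite_subset[OF _ finite_factorizations[OF assms]]) (auto simp: pp_factors_def)

lemma finite_Sym: "finite (Sym n)"
  by (simp add: Sym_def finite_permutations)

lemma finite_Sym_factors: "finite (Sym_factors n m lam \<delta> z)"
  by (rule finite_subset[of _ "Sym n \<times> Sym n"]) (auto simp: Sym_factors_def finite_Sym)

lemma pp_mult_act:
  assumes "bij \<sigma>"
  shows "pp_mult (pp_act \<sigma> x) (pp_act \<sigma> y) = pp_act \<sigma> (pp_mult x y)"
  using assms by (simp add: pp_mult_def pp_act_def image_Un fun_eq_iff bij_is_inj)

lemma pp_type_act:
  assumes "bij \<sigma>" "\<forall>a\<in>{1..m}. \<sigma> a = a"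
  shows "pp_type m (pp_act \<sigma> x) = pp_type m x"
  using marked_cycle_type_conj[OF assms] by (simp add: pp_type_def pp_act_def)

lemma conj_cancel:
  assumes "bij \<sigma>" "\<sigma> \<circ> p \<circ> inv \<sigma> = \<sigma> \<circ> q \<circ> inv \<sigma>"
  shows "p = q"
proof
  fix a
  show "p a = q a"
    using fun_cong[OF assms(2), of "\<sigma> a"] assms(1) by (simp add: bij_is_inj inj_eq)
qed

lemma inj_pp_act: "bij \<sigma> \<Longrightarrow> inj (pp_act \<sigma>)"
  by (intro injI prod_eqI) (auto simp: pp_act_def bij_is_inj inj_image_eq_iff dest: conj_cancel)

text \<open>Conjugating both factors simultaneously carries factorizations of \<open>z\<close>
  injectively to factorizations of \<open>w\<close> without changing types. One inequality suffices,
  by exchanging \<open>z\<close> and \<open>w\<close>.\<close>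

lemma card_pp_factors_cong:
  assumes "z \<in> partial_perms m" "w \<in> partial_perms m" "pp_type m z = pp_type m w"
  shows "card (pp_factors m lam \<delta> z) = card (pp_factors m lam \<delta> w)"
proof -
  have "card (pp_factors m lam \<delta> z) \<le> card (pp_factors m lam \<delta> w)"
    if zw: "z \<in> partial_perms m" "w \<in> partial_perms m" "pp_type m z = pp_type m w" for z w
  proof -
    obtain \<sigma> where \<sigma>: "\<sigma> permutes (fst z \<union> fst w)" "\<forall>a\<in>{1..m}. \<sigma> a = a" "pp_act \<sigma> z = w"
      using pp_type_eq_imp_conj[OF zw] by blast
    have bij: "bij \<sigma>" using \<sigma>(1) by (rule permutes_bij)
    have "finite (fst z \<union> fst w)" "fst z \<union> fst w \<subseteq> {1..}"
      using zw by (auto simp: partial_perms_def)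
    moreover have "{x. \<sigma> x \<noteq> x} \<subseteq> fst z \<union> fst w"
      using permutes_not_in[OF \<sigma>(1)] by blast
    ultimately have "\<sigma> \<in> Stab_nat m"
      using \<sigma>(2) permutes_subset[OF \<sigma>(1)] finite_subset[of "{x. \<sigma> x \<noteq> x}"]
      by (simp add: Stab_nat_def)
    then show ?thesis
      using \<sigma>(2,3) inj_pp_act[OF bij]
      by (intro card_inj_on_le[of "map_prod (pp_act \<sigma>) (pp_act \<sigma>)"] finite_pp_factors[OF zw(2)])
        (auto simp: pp_factors_def pp_mult_act[OF bij] pp_type_act[OF bij] intro: pp_act_mem
          intro!: inj_onI dest: injD)
  qed
  from this[OF assms] this[OF assms(2,1) assms(3)[symmetric]] show ?thesis by simp
qed

lemma card_Sym_factors_cong: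
  assumes "m \<le> n" "z \<in> Sym n" "w \<in> Sym n"
    and "marked_cycle_type m {1..n} z = marked_cycle_type m {1..n} w"
  shows "card (Sym_factors n m lam \<delta> z) = card (Sym_factors n m lam \<delta> w)"
proof -
  have "card (Sym_factors n m lam \<delta> z) \<le> card (Sym_factors n m lam \<delta> w)"
    if zw: "z \<in> Sym n" "w \<in> Sym n" "marked_cycle_type m {1..n} z = marked_cycle_type m {1..n} w" for z w
  proof -
    \<comment> \<open>Viewed as partial permutations with full domain \<open>{1..n}\<close>, the two
      elements are conjugate inside \<open>Sym n\<close>.\<close>
    have "({1..n}, z) \<in> partial_perms m" "({1..n}, w) \<in> partial_perms m"
      using zw assms(1) by (auto simp: partial_perms_def Sym_def)
    from pp_type_eq_imp_conj[OF this] zw(3)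
    obtain \<sigma> where \<sigma>: "\<sigma> permutes {1..n}" "\<forall>a\<in>{1..m}. \<sigma> a = a" "\<sigma> \<circ> z \<circ> inv \<sigma> = w"
      by (auto simp: pp_type_def pp_act_def)
    have bij: "bij \<sigma>" using \<sigma>(1) by (rule permutes_bij)
    define h where "h p = \<sigma> \<circ> p \<circ> inv \<sigma>" for p
    have "inj h" using conj_cancel[OF bij] by (auto intro: injI simp: h_def)
    moreover have "h p \<in> Sym n" if "p \<in> Sym n" for p
      using that \<sigma>(1) by (simp add: h_def Sym_def permutes_compose permutes_inv)
    moreover have "h p \<circ> h q = h (p \<circ> q)" for p q
      using bij by (simp add: h_def fun_eq_iff bij_is_inj)
    moreover have "marked_cycle_type m {1..n} (h p) = marked_cycle_type m {1..n} p" for p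
      using marked_cycle_type_conj[OF bij \<sigma>(2), of "{1..n}" p] permutes_image[OF \<sigma>(1)]
      by (simp add: h_def)
    moreover have "h z = w" using \<sigma>(3) by (simp add: h_def)
    ultimately show ?thesis
      by (intro card_inj_on_le[of "map_prod h h"] finite_Sym_factors)
        (auto simp: Sym_factors_def intro!: inj_onI dest: injD)
  qed
  from this[OF assms(2-4)] this[OF assms(3,2) assms(4)[symmetric]] show ?thesis by simp
qed

text \<open>\<open>A_sum\<close> is the indicator of a fibre of \<open>pp_type m\<close>, and
  conjugation makes the product constant on fibres, so \<open>coefficients_fibre\<close> reads the
  coefficient off at the single point \<open>z\<close>.\<close>

lemma partial_coeff_eq_card:
  assumes "z \<in> partial_perms m"
  shows "partial_coeff m lam \<delta> (pp_type m z) = of_nat (card (pp_factors m lam \<delta> z))"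
proof -
  have A: "A_sum m \<rho> = (\<lambda>x. if x \<in> partial_perms m \<and> pp_type m x = \<rho> then 1 else 0)" for \<rho>
    by (auto simp: A_sum_def pp_type_def)
  have v: "B_mult m (A_sum m lam) (A_sum m \<delta>) x = of_nat (card (pp_factors m lam \<delta> x))"
    if "x \<in> partial_perms m" for x
    unfolding A conv_indicators[OF finite_factorizations[OF that]]
    by (intro arg_cong[of _ _ of_nat] arg_cong[of _ _ card]) (auto simp: pp_factors_def)
  have "B_mult m (A_sum m lam) (A_sum m \<delta>) x = 0" if "x \<notin> partial_perms m" for x
  proof -
    \<comment> \<open>Closure under \<open>pp_mult\<close> leaves an outside element without
      factorizations, so the sum for it is empty.\<close>
    have "pp_mult y z \<in> partial_perms m" if "y \<in> partial_perms m" "z \<in> partial_perms m" for y z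
      using that
      by (auto simp: partial_perms_def pp_mult_def intro!: permutes_compose intro: permutes_subset)
    with that have "{(y, z). y \<in> partial_perms m \<and> z \<in> partial_perms m \<and> pp_mult y z = x} = {}"
      by auto
    then show ?thesis by (simp only: conv_def sum.empty)
  qed
  moreover have "B_mult m (A_sum m lam) (A_sum m \<delta>) x = B_mult m (A_sum m lam) (A_sum m \<delta>) y"
    if "x \<in> partial_perms m" "y \<in> partial_perms m" "pp_type m x = pp_type m y" for x y
    using card_pp_factors_cong[OF that] by (simp add: v that)
  moreover have "A_sum m \<rho> x = (if x \<in> partial_perms m \<and> pp_type m x = \<rho> then 1 else 0)" for \<rho> x
    by (simp only: A)
  ultimately have "partial_coeff m lam \<delta> (pp_type m z) = B_mult m (A_sum m lam) (A_sum m \<delta>) z"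
    unfolding partial_coeff_def
    by (intro coefficients_fibre[OF _ marked_shapes_eq _ _ assms]) blast+
  then show ?thesis by (simp only: v[OF assms])
qed

lemma centraliser_coeff_eq_card:
  assumes "m \<le> n" "z \<in> Sym n"
  shows "centraliser_coeff n m lam \<delta> (marked_cycle_type m {1..n} z) =
    int (card (Sym_factors n m lam \<delta> z))"
proof -
  have v: "group_ring_mult n (K_sum n m lam) (K_sum n m \<delta>) x = int (card (Sym_factors n m lam \<delta> x))" for x
  proof -
    have fin: "finite {(y, z). y \<in> Sym n \<and> z \<in> Sym n \<and> y \<circ> z = x}"
      by (rule finite_subset[of _ "Sym n \<times> Sym n"]) (auto simp: finite_Sym)
    show ?thesis
      unfolding K_sum_def conv_indicators[OF fin]
      by (intro arg_cong[of _ _ int] arg_cong[of _ _ card]) (auto simp: Sym_factors_def)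
  qed
  have "K_sum n m \<rho> x = (if x \<in> Sym n \<and> marked_cycle_type m {1..n} x = \<rho> then 1 else 0)" for \<rho> x
    by (simp only: K_sum_def)
  moreover have "group_ring_mult n (K_sum n m lam) (K_sum n m \<delta>) x =
      group_ring_mult n (K_sum n m lam) (K_sum n m \<delta>) y"
    if "x \<in> Sym n" "y \<in> Sym n" "marked_cycle_type m {1..n} x = marked_cycle_type m {1..n} y" for x y
    using card_Sym_factors_cong[OF assms(1) that] by (simp only: v)
  ultimately have "centraliser_coeff n m lam \<delta> (marked_cycle_type m {1..n} z) =
    group_ring_mult n (K_sum n m lam) (K_sum n m \<delta>) z"
    unfolding centraliser_coeff_def
    by (intro coefficients_fibre[OF _ marked_shapes_of_size_eq[OF assms(1)] _ _ assms(2)] conv_Sym_outside) blast+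
  then show ?thesis by (simp only: v)
qed

section \<open>Minimal domains\<close>

lemma support_fixed_point:
  assumes "p x = x"
  shows "support p x = [x]"
proof -
  have "least_power p x = 1"
    unfolding least_power_def using assms by (intro Least_equality) auto
  then show ?thesis by simp
qed

text \<open>The words \<open>[x]\<close> are distinct before marking, so each fixed point is counted
  separately although all of them become \<open>Cyc [None]\<close>.\<close>

lemma marked_cycle_type_fixed_points:
  assumes "finite e" "e \<inter> {1..m} = {}" "\<forall>x\<in>e. p x = x"
  shows "marked_cycle_type m e p = replicate_mset (card e) (Cyc [None])"
proof -
  have "cycles_of e p = (\<lambda>x. Cyc [x]) ` e"
    unfolding cycles_of_def using assms(3) by (intro image_cong refl arg_cong[of _ _ Cyc] support_fixed_point) blast
  moreover have "inj_on (\<lambda>x. Cyc [x]) e"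
    by (rule inj_onI) (simp add: Cyc_eq_iff)
  moreover have "map_cyc (mark m) (Cyc [x]) = Cyc [None]" if "x \<in> e" for x
    using that assms(2) by (auto simp: map_cyc_Cyc mark_def disjoint_iff)
  ultimately have "marked_cycle_type m e p = image_mset (\<lambda>x. Cyc [None]) (mset_set e)"
    using assms(1)
    by (auto simp: marked_cycle_type_def image_mset.compositionality
        simp flip: image_mset_mset_set intro!: image_mset_cong)
  then show ?thesis by (simp add: image_mset_const_eq)
qed

text \<open>\<open>p\<close> fixes every point of \<open>e - d\<close>, and none of these lies in
  \<open>{1..m}\<close>. Such additional points are the source of the shapes
  \<open>add_stars \<rho> k\<close>.\<close>

lemma marked_cycle_type_extend:
  assumes "finite e" "d \<subseteq> e" "{1..m} \<subseteq> d" "p permutes d"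
  shows "marked_cycle_type m e p = add_stars (marked_cycle_type m d p) (card e - card d)"
proof -
  have fin: "finite d" using assms finite_subset by blast
  have off: "\<forall>x\<in>e - d. p x = x" using permutes_not_in[OF assms(4)] by blast
  have "permutation p" using fin assms(4) by (auto simp: permutation_permutes)
  then have "marked_cycle_type m (d \<union> (e - d)) p =
      marked_cycle_type m d p + marked_cycle_type m (e - d) p"
    unfolding marked_cycle_type_eq using assms fin off permutes_image[OF assms(4)]
    by (intro cycle_type_Un) auto
  also have "marked_cycle_type m (e - d) p = replicate_mset (card (e - d)) (Cyc [None])"
    using assms off by (intro marked_cycle_type_fixed_points) auto
  finally show ?thesis
    using assms(2) fin by (simp add: add_stars_def card_Diff_subset Un_absorb1)
qed

lemma m1_add_stars: "m1 (add_stars \<rho> k) = m1 \<rho> + k"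
  by (simp add: m1_def add_stars_def)

lemma shape_size_add_stars: "shape_size m (add_stars \<rho> k) = shape_size m \<rho> + k"
proof -
  have "(\<Sum>C\<in>#replicate_mset k (Cyc [None]). letters C) = replicate_mset k (None :: nat option)"
    by (induct k) (simp_all add: letters_Cyc)
  then show ?thesis
    by (simp add: shape_size_def all_letters_def add_stars_def)
qed

lemma add_stars_in_marked_shapes:
  assumes "\<rho> \<in> marked_shapes m"
  shows "add_stars \<rho> k \<in> marked_shapes m"
proof -
  have "all_letters (add_stars \<rho> k) = all_letters \<rho> + replicate_mset k None"
    by (induct k) (simp_all add: all_letters_def add_stars_def letters_Cyc)
  moreover have "letters C \<noteq> {#}" if "C \<in># add_stars \<rho> k" for C
    using that assms by (auto simp: add_stars_def marked_shapes_def letters_Cyc split: if_splits)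
  ultimately show ?thesis
    using assms by (auto simp: marked_shapes_def split: if_splits)
qed

text \<open>The smallest \<open>d\<close> such that \<open>(d, p)\<close> is an \<open>m\<close>-partial permutation; the shape is proper
  exactly for this \<open>d\<close>.\<close>

definition core :: "nat \<Rightarrow> (nat \<Rightarrow> nat) \<Rightarrow> nat set" where
  "core m p = {1..m} \<union> {x. p x \<noteq> x}"

lemma core_subset:
  assumes "{1..m} \<subseteq> d" "p permutes d"
  shows "core m p \<subseteq> d"
  using assms permutes_not_in by (fastforce simp: core_def)

lemma permutes_core:
  assumes "p permutes d"
  shows "p permutes core m p"
  using assms by (rule permutes_superset) (auto simp: core_def)

text \<open>A point of \<open>d\<close> outside \<open>core m p\<close> is an unmarked fixed point,
  that is, a cycle \<open>Cyc [None]\<close>, and every such cycle arises this way.\<close>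

lemma proper_marked_cycle_type_iff:
  assumes "finite d" "{1..m} \<subseteq> d" "p permutes d"
  shows "proper (marked_cycle_type m d p) \<longleftrightarrow> d = core m p"
proof
  assume proper: "proper (marked_cycle_type m d p)"
  have sub: "core m p \<subseteq> d" using assms(2,3) by (rule core_subset)
  have "marked_cycle_type m d p = add_stars (marked_cycle_type m (core m p) p) (card d - card (core m p))"
    using assms(1) sub permutes_core[OF assms(3)]
    by (intro marked_cycle_type_extend) (simp_all add: core_def)
  then have "card d \<le> card (core m p)"
    using proper by (simp add: proper_def m1_add_stars)
  then show "d = core m p"
    using card_seteq[OF assms(1) sub] by simp
next
  assume d: "d = core m p"
  show "proper (marked_cycle_type m d p)"
  proof (rule ccontr)
    assume "\<not> proper (marked_cycle_type m d p)"
    then have "Cyc [None] \<in># cycle_type (mark m) d p"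
      by (simp add: proper_def m1_def marked_cycle_type_eq not_in_iff)
    moreover have perm: "permutation p" using assms by (auto simp: permutation_permutes)
    ultimately obtain x where x: "x \<in> d" "[None] = map (mark m) (support p x)"
      using cycle_typeE[of p d "[None]" "mark m"] assms(1) permutes_image[OF assms(3)] by blast
    have "least_power p x = 1"
      using arg_cong[OF x(2), of length] by simp
    then have "p x = x" "mark m x = None"
      using least_power_of_permutation(1)[OF perm, of x] x(2) by simp_all
    then show False
      using x(1) d by (auto simp: core_def mark_def)
  qed
qed

lemma core_in_partial_perms:
  assumes "m \<le> n" "p \<in> Sym n"
  shows "(core m p, p) \<in> partial_perms m" "core m p \<subseteq> {1..n}"
proof -
  have p: "p permutes {1..n}" using assms(2) by (simp add: Sym_def)
  show sub: "core m p \<subseteq> {1..n}"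
    using assms(1) p by (intro core_subset) auto
  then have "finite (core m p)" by (rule finite_subset) simp
  then show "(core m p, p) \<in> partial_perms m"
    using sub permutes_core[OF p, of m] by (auto simp: partial_perms_def core_def)
qed

text \<open>\<open>m1\<close> counts exactly the cycles added to a proper shape, so a proper shape
  can be recovered from its padding. This trades types on all of \<open>{1..n}\<close> for types on
  the minimal domain.\<close>

lemma marked_cycle_type_eq_pad_iff:
  assumes "m \<le> n" "p \<in> Sym n" "proper lam" "shape_size m lam \<le> n"
  shows "marked_cycle_type m {1..n} p = pad m lam n \<longleftrightarrow> pp_type m (core m p, p) = lam"
proof -
  note c = core_in_partial_perms[OF assms(1,2)]
  then have d: "finite (core m p)" "{1..m} \<subseteq> core m p" "p permutes core m p"
    by (auto simp: partial_perms_def)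
  let ?t = "marked_cycle_type m (core m p) p"
  have ext: "marked_cycle_type m {1..n} p = add_stars ?t (n - card (core m p))"
    using marked_cycle_type_extend[of "{1..n}" "core m p" m p] c(2) d by simp
  have size: "shape_size m ?t = card (core m p)"
    using d by (rule shape_size_marked_cycle_type)
  have "m1 ?t = 0" "m1 lam = 0"
    using proper_marked_cycle_type_iff[OF d] assms(3) by (simp_all add: proper_def)
  then have "?t = lam" if eq: "add_stars ?t a = add_stars lam b" for a b
  proof -
    have "a = b"
      using arg_cong[OF eq, of m1] \<open>m1 ?t = 0\<close> \<open>m1 lam = 0\<close> by (simp add: m1_add_stars)
    then show ?thesis using eq by (simp add: add_stars_def)
  qed
  then show ?thesis
    unfolding ext pad_def using size by (auto simp: pp_type_def)
qed

section \<open>Factorizations by domain\<close>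

text \<open>Properness of \<open>lam\<close> and \<open>\<delta>\<close> forces the domains of the
  factors to be their cores, so forgetting the domains inverts the map. The index \<open>d\<close>
  is the union of the two cores.\<close>

lemma Sym_factors_decomposition:
  assumes "m \<le> n" "z \<in> Sym n" "proper lam" "proper \<delta>" "shape_size m lam \<le> n" "shape_size m \<delta> \<le> n"
  shows "bij_betw (\<lambda>(x, y). ((core m x, x), (core m y, y)))
    (Sym_factors n m (pad m lam n) (pad m \<delta> n) z)
    (\<Union>d\<in>{d. core m z \<subseteq> d \<and> d \<subseteq> {1..n}}. pp_factors m lam \<delta> (d, z))"
    (is "bij_betw ?h ?S ?T")
proof (rule bij_betwI[where g = "\<lambda>(x, y). (snd x, snd y)"])
  have S: "(x, y) \<in> ?S \<longleftrightarrow> x \<in> Sym n \<and> y \<in> Sym n \<and> x \<circ> y = z \<and>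
      pp_type m (core m x, x) = lam \<and> pp_type m (core m y, y) = \<delta>" for x y
    using marked_cycle_type_eq_pad_iff[OF assms(1) _ assms(3,5)]
      marked_cycle_type_eq_pad_iff[OF assms(1) _ assms(4,6)]
    by (auto simp: Sym_factors_def)
  \<comment> \<open>Describes the union on the right without mentioning \<open>d\<close>.\<close>
  have T: "w \<in> ?T \<longleftrightarrow> (\<exists>x y. w = ((core m x, x), (core m y, y)) \<and> (x, y) \<in> ?S)" for w
  proof
    assume "w \<in> ?T"
    then obtain d a x b y where w: "w = ((a, x), (b, y))" and d: "d \<subseteq> {1..n}"
      and f: "((a, x), (b, y)) \<in> pp_factors m lam \<delta> (d, z)"
      by (cases w) force
    have ax: "(a, x) \<in> partial_perms m" "pp_type m (a, x) = lam"
      and "by": "(b, y) \<in> partial_perms m" "pp_type m (b, y) = \<delta>"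
      and ab: "a \<union> b = d" "x \<circ> y = z"
      using f by (auto simp: pp_factors_def pp_mult_def)
    have "a = core m x" "b = core m y"
      using proper_marked_cycle_type_iff[of a m x] proper_marked_cycle_type_iff[of b m y] ax "by" assms(3,4)
      by (auto simp: partial_perms_def pp_type_def)
    moreover have "x \<in> Sym n" "y \<in> Sym n"
      using ax(1) "by"(1) ab(1) d permutes_subset[of x a "{1..n}"] permutes_subset[of y b "{1..n}"]
      by (auto simp: partial_perms_def Sym_def)
    ultimately show "\<exists>x y. w = ((core m x, x), (core m y, y)) \<and> (x, y) \<in> ?S"
      using w ax "by" ab S by blast
  next
    assume "\<exists>x y. w = ((core m x, x), (core m y, y)) \<and> (x, y) \<in> ?S"
    then obtain x y where w: "w = ((core m x, x), (core m y, y))" and xy: "(x, y) \<in> ?S"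
      by blast
    have "w \<in> pp_factors m lam \<delta> (core m x \<union> core m y, z)"
      using xy core_in_partial_perms(1)[OF assms(1)] unfolding S
      by (auto simp: w pp_factors_def pp_mult_def)
    \<comment> \<open>A point moved by the composition \<open>z\<close> is moved by \<open>x\<close>
      or by \<open>y\<close>.\<close>
    moreover have "core m z \<subseteq> core m x \<union> core m y"
      using xy unfolding S by (auto simp: core_def)
    moreover have "core m x \<union> core m y \<subseteq> {1..n}"
      using xy core_in_partial_perms(2)[OF assms(1)] unfolding S by blast
    ultimately show "w \<in> ?T" by blast
  qed
  show "?h \<in> ?S \<rightarrow> ?T"
  proof
    fix w assume "w \<in> ?S"
    then show "?h w \<in> ?T" by (intro T[THEN iffD2]) (cases w, auto)
  qed
  show "(\<lambda>(x, y). (snd x, snd y)) \<in> ?T \<rightarrow> ?S"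
  proof
    fix w assume "w \<in> ?T"
    from T[THEN iffD1, OF this] show "(case w of (x, y) \<Rightarrow> (snd x, snd y)) \<in> ?S" by auto
  qed
  show "(\<lambda>(x, y). (snd x, snd y)) (?h w) = w" for w
    by (simp split: prod.split)
  show "?h ((\<lambda>(x, y). (snd x, snd y)) w) = w" if "w \<in> ?T" for w
    using T[THEN iffD1, OF that] by auto
qed

text \<open>Grouping by cardinality; the binomial coefficients of the final formula come from
  here.\<close>

lemma sum_Pow_card:
  fixes g :: "nat \<Rightarrow> 'r::comm_semiring_1"
  assumes "finite A"
  shows "(\<Sum>B\<in>Pow A. g (card B)) = (\<Sum>k = 0..card A. g k * of_nat (card A choose k))"
proof -
  have "(\<Sum>B\<in>Pow A. g (card B)) = (\<Sum>k = 0..card A. \<Sum>B | B \<in> Pow A \<and> card B = k. g (card B))"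
    using assms by (intro sum.group[symmetric]) (auto intro: card_mono)
  also have "\<dots> = (\<Sum>k = 0..card A. g k * of_nat (card A choose k))"
    using n_subsets[OF assms] by (intro sum.cong) (simp_all add: Pow_def mult.commute)
  finally show ?thesis .
qed

lemma card_Sym_factors:
  assumes "m \<le> n" "z \<in> Sym n" "proper lam" "proper \<delta>" "shape_size m lam \<le> n" "shape_size m \<delta> \<le> n"
  shows "card (Sym_factors n m (pad m lam n) (pad m \<delta> n) z) =
    (\<Sum>e\<in>Pow ({1..n} - core m z). card (pp_factors m lam \<delta> (core m z \<union> e, z)))"
proof -
  let ?D = "{d. core m z \<subseteq> d \<and> d \<subseteq> {1..n}}"
  note c = core_in_partial_perms[OF assms(1,2)]
  have pp: "(d, z) \<in> partial_perms m" if "d \<in> ?D" for d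
    using that c permutes_subset[of z "core m z" d] finite_subset[of d "{1..n}"]
    by (auto simp: partial_perms_def)
  have "finite ?D" by (rule finite_subset[of _ "Pow {1..n}"]) auto
  have "card (Sym_factors n m (pad m lam n) (pad m \<delta> n) z) =
      card (\<Union>d\<in>?D. pp_factors m lam \<delta> (d, z))"
    using Sym_factors_decomposition[OF assms] by (rule bij_betw_same_card)
  \<comment> \<open>The product of a factorization determines \<open>d\<close>, so the sets for
    different \<open>d\<close> are disjoint.\<close>
  also have "\<dots> = (\<Sum>d\<in>?D. card (pp_factors m lam \<delta> (d, z)))"
    using \<open>finite ?D\<close> finite_pp_factors[OF pp]
    by (intro card_UN_disjoint) (auto simp: pp_factors_def)
  \<comment> \<open>A domain \<open>d\<close> is encoded by the set \<open>e\<close> of points that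
    it adds to the core.\<close>
  also have "\<dots> = (\<Sum>e\<in>Pow ({1..n} - core m z). card (pp_factors m lam \<delta> (core m z \<union> e, z)))"
    using c(2)
    by (intro sum.reindex_bij_witness[where i = "\<lambda>e. core m z \<union> e" and j = "\<lambda>d. d - core m z"])
      (auto simp: Un_absorb1 intro!: arg_cong[of _ _ card] arg_cong2[of _ _ _ _ "pp_factors m lam"])
  finally show ?thesis .
qed

text \<open>Independence of \<open>n\<close> is expressed by \<open>partial_coeff\<close> not taking
  \<open>n\<close> as an argument; integrality is membership in \<open>\<int>\<close> because its
  values are complex.\<close>

theorem theorem0p8:
  fixes m n :: nat and lam \<delta> \<rho> :: shape
  assumes "lam \<in> marked_shapes m" "\<delta> \<in> marked_shapes m" "\<rho> \<in> marked_shapes m"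
    and "proper lam" "proper \<delta>" "proper \<rho>"
    and "n \<ge> m" "n \<ge> shape_size m lam" "n \<ge> shape_size m \<delta>" "n \<ge> shape_size m \<rho>"
  shows "(\<forall>j. partial_coeff m lam \<delta> (add_stars \<rho> j) \<in> \<int>) \<and>
    of_int (centraliser_coeff n m (pad m lam n) (pad m \<delta> n) (pad m \<rho> n)) =
      (\<Sum>j = 0..n - shape_size m \<rho>.
         partial_coeff m lam \<delta> (add_stars \<rho> j) * of_nat ((n - shape_size m \<rho>) choose j))"
proof
  show "\<forall>j. partial_coeff m lam \<delta> (add_stars \<rho> j) \<in> \<int>"
  proof
    fix j
    \<comment> \<open>Every shape is the type of some partial permutation, and there the coefficient
      is a cardinality.\<close>
    have "add_stars \<rho> j \<in> pp_type m ` partial_perms m"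
      using add_stars_in_marked_shapes[OF assms(3)] by (simp only: marked_shapes_eq)
    then obtain x where "x \<in> partial_perms m" "add_stars \<rho> j = pp_type m x" by blast
    then show "partial_coeff m lam \<delta> (add_stars \<rho> j) \<in> \<int>"
      by (simp add: partial_coeff_eq_card)
  qed
next
  have "pad m \<rho> n \<in> marked_shapes_of_size m n"
    using assms(10) add_stars_in_marked_shapes[OF assms(3)]
    by (simp add: marked_shapes_of_size_def pad_def shape_size_add_stars)
  \<comment> \<open>A fixed representative of the padded shape, at which factorizations are
    counted.\<close>
  then obtain z where z: "z \<in> Sym n" "marked_cycle_type m {1..n} z = pad m \<rho> n"
    unfolding marked_shapes_of_size_eq[OF assms(7)] by (metis imageE)
  let ?c = "core m z"
  let ?k = "\<lambda>j. partial_coeff m lam \<delta> (add_stars \<rho> j)"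
  note c = core_in_partial_perms[OF assms(7) z(1)]
  then have d: "finite ?c" "{1..m} \<subseteq> ?c" "z permutes ?c"
    by (auto simp: partial_perms_def)
  \<comment> \<open>Properness of \<open>\<rho>\<close> allows the padding to be undone on the
    minimal domain.\<close>
  have type: "marked_cycle_type m ?c z = \<rho>"
    using marked_cycle_type_eq_pad_iff[OF assms(7) z(1) assms(6,10)] z(2) by (simp add: pp_type_def)
  then have card_c: "card ?c = shape_size m \<rho>"
    using shape_size_marked_cycle_type[OF d] by simp
  \<comment> \<open>Only the size of \<open>e\<close> matters: adding \<open>e\<close> to the core
    adds \<open>card e\<close> unmarked fixed points.\<close>
  have count: "of_nat (card (pp_factors m lam \<delta> (?c \<union> e, z))) = ?k (card e)"
    if "e \<in> Pow ({1..n} - ?c)" for e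
  proof -
    have fin: "finite e" using that finite_subset[of e "{1..n}"] by auto
    have "(?c \<union> e, z) \<in> partial_perms m"
      using that c d fin permutes_subset[OF d(3), of "?c \<union> e"] by (auto simp: partial_perms_def)
    moreover have "pp_type m (?c \<union> e, z) = add_stars \<rho> (card e)"
    proof -
      have "card (?c \<union> e) = card ?c + card e"
        using that fin d(1) by (intro card_Un_disjoint) auto
      then show ?thesis
        using marked_cycle_type_extend[of "?c \<union> e" ?c m z] d fin type by (simp add: pp_type_def)
    qed
    ultimately show ?thesis using partial_coeff_eq_card by metis
  qed
  have "of_int (centraliser_coeff n m (pad m lam n) (pad m \<delta> n) (pad m \<rho> n)) =
      (of_nat (card (Sym_factors n m (pad m lam n) (pad m \<delta> n) z)) :: complex)"
    using centraliser_coeff_eq_card[OF assms(7) z(1)] z(2) by simp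
  also have "\<dots> = (\<Sum>e\<in>Pow ({1..n} - ?c). ?k (card e))"
    unfolding card_Sym_factors[OF assms(7) z(1) assms(4,5,8,9)] of_nat_sum
    by (intro sum.cong refl count)
  also have "\<dots> = (\<Sum>j = 0..card ({1..n} - ?c). ?k j * of_nat (card ({1..n} - ?c) choose j))"
    by (rule sum_Pow_card) simp
  also have "card ({1..n} - ?c) = n - shape_size m \<rho>"
    using d(1) c(2) card_c by (simp add: card_Diff_subset)
  finally show "of_int (centraliser_coeff n m (pad m lam n) (pad m \<delta> n) (pad m \<rho> n)) =
      (\<Sum>j = 0..n - shape_size m \<rho>. ?k j * of_nat ((n - shape_size m \<rho>) choose j))" .
qed

end
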